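(* Let $\Omega\subseteq\mathbb{R}^D$ be open and $\phi=(\phi_1,\dots,\phi_d)\in\mathcal{C}^\infty(\Omega,\mathbb{R}^d)$. Assume that $\theta\mapsto\dim\big(\operatorname{Lie}(W_\phi)(\theta)\big)$ is locally constant on $\Omega$. Then each $\theta\in\Omega$ admits an open neighborhood $\Omega'\subseteq\Omega$ such that there exist $D-\dim(\operatorname{Lie}(W_\phi)(\theta))$, and no more, independent functions on $\Omega'$ conserved through $(W_\phi)_{|\Omega'}$; that is, there are $D-\dim(\operatorname{Lie}(W_\phi)(\theta))$ (and no more) independent conservation laws of $\phi$ on $\Omega'$.
   Context: $W_\phi=\operatorname{span}\{\nabla\phi_1,\dots,\nabla\phi_d\}$ is the finite-dimensional real vector space of vector fields on $\Omega$ spanned by the gradients of the coordinates of $\phi$; $(W_\phi)_{|\Omega'}$ is the set of restrictions to $\Omega'$ of its elements. The space $\mathcal{C}^\infty(\Omega,\mathbb{R}^D)$ of smooth vector fields is a Lie algebra for $[\chi_1,\chi_2](\theta)=\partial\chi_1(\theta)\chi_2(\theta)-\partial\chi_2(\theta)\chi_1(\theta)$, with $\partial\chi$ the Jacobian; $\operatorname{Lie}(W)$ is the smallest Lie subalgebra containing $W$. The trace of a set $W$ of vector fields at $\theta$ is $W(\theta)=\operatorname{span}\{\chi(\theta):\chi\in W\}\subseteq\mathbb{R}^D$. A function $h:\Omega'\to\mathbb{R}$ is conserved through a set $W$ of $\mathcal{C}^1$ vector fields on $\Omega'$ if for every $\chi\in W$ and every $\theta_{\rm init}\in\Omega'$,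 $h$ is constant along the maximal solution ($t\ge0$) in $\Omega'$ of $\dot\theta(t)=\chi(\theta(t))$, $\theta(0)=\theta_{\rm init}$. A conservation law of $\phi$ on $\Omega'$ is a function conserved through $(W_\phi)_{|\Omega'}$. A family $(h_1,\dots,h_N)$ of $\mathcal{C}^1$ conserved functions on $\Omega'$ is independent if $\nabla h_1(\theta'),\dots,\nabla h_N(\theta')$ are linearly independent for all $\theta'\in\Omega'$. *)

theory Defs
  imports "HOL-Analysis.Analysis"
begin

text \<open>
  \<open>Ck_on k S f\<close>: \<open>f\<close> is of class \<open>C^k\<close> on \<open>S\<close>, intended for open \<open>S\<close> and finite-dimensional
  domain. There, continuity of all iterated directional derivatives is the same as continuity
  of all partial derivatives up to order \<open>k\<close>.
\<close>

fun Ck_on :: "nat \<Rightarrow> 'a::real_normed_vector set \<Rightarrow> ('a \<Rightarrow> 'b::real_normed_vector) \<Rightarrow> bool" where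
  "Ck_on 0 S f \<longleftrightarrow> continuous_on S f"
| "Ck_on (Suc k) S f \<longleftrightarrow>
     (\<forall>x\<in>S. f differentiable (at x)) \<and> (\<forall>v. Ck_on k S (\<lambda>x. frechet_derivative f (at x) v))"

definition smooth_on :: "'a::real_normed_vector set \<Rightarrow> ('a \<Rightarrow> 'b::real_normed_vector) \<Rightarrow> bool" where
  "smooth_on S f \<longleftrightarrow> (\<forall>k. Ck_on k S f)"

definition grad :: "(real^'n \<Rightarrow> real) \<Rightarrow> real^'n \<Rightarrow> real^'n" where
  "grad f x = (\<chi> j. frechet_derivative f (at x) (axis j 1))"

text \<open>
  A vector field on \<open>\<Omega>\<close> is represented by a total function that is \<^const>\<open>undefined\<close> outside \<open>\<Omega>\<close>
  (\<^const>\<open>extensional\<close>), so that equality of representatives is equality on \<open>\<Omega>\<close>.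
\<close>

definition smooth_fields :: "(real^'n) set \<Rightarrow> (real^'n \<Rightarrow> real^'n) set" where
  "smooth_fields \<Omega> = {\<xi> \<in> extensional \<Omega>. smooth_on \<Omega> \<xi>}"

definition lie_bracket ::
    "(real^'n) set \<Rightarrow> (real^'n \<Rightarrow> real^'n) \<Rightarrow> (real^'n \<Rightarrow> real^'n) \<Rightarrow> (real^'n \<Rightarrow> real^'n)" where
  "lie_bracket \<Omega> \<xi>1 \<xi>2 =
     (\<lambda>\<theta>\<in>\<Omega>. jacobian \<xi>1 (at \<theta>) *v \<xi>2 \<theta> - jacobian \<xi>2 (at \<theta>) *v \<xi>1 \<theta>)"

definition lie_subalgebra :: "(real^'n) set \<Rightarrow> (real^'n \<Rightarrow> real^'n) set \<Rightarrow> bool" where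
  "lie_subalgebra \<Omega> L \<longleftrightarrow>
     L \<subseteq> smooth_fields \<Omega> \<and>
     (\<lambda>\<theta>\<in>\<Omega>. 0) \<in> L \<and>
     (\<forall>\<xi>1\<in>L. \<forall>\<xi>2\<in>L. (\<lambda>\<theta>\<in>\<Omega>. \<xi>1 \<theta> + \<xi>2 \<theta>) \<in> L) \<and>
     (\<forall>c. \<forall>\<xi>\<in>L. (\<lambda>\<theta>\<in>\<Omega>. c *\<^sub>R \<xi> \<theta>) \<in> L) \<and>
     (\<forall>\<xi>1\<in>L. \<forall>\<xi>2\<in>L. lie_bracket \<Omega> \<xi>1 \<xi>2 \<in> L)"

definition Lie :: "(real^'n) set \<Rightarrow> (real^'n \<Rightarrow> real^'n) set \<Rightarrow> (real^'n \<Rightarrow> real^'n) set" where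
  "Lie \<Omega> W = lie_subalgebra \<Omega> hull W"

definition W_space :: "(real^'n) set \<Rightarrow> (real^'n \<Rightarrow> real^'d) \<Rightarrow> (real^'n \<Rightarrow> real^'n) set" where
  "W_space \<Omega> \<phi> =
     {(\<lambda>\<theta>\<in>\<Omega>. \<Sum>i\<in>UNIV. c i *\<^sub>R grad (\<lambda>x. \<phi> x $ i) \<theta>) | c :: 'd \<Rightarrow> real. True}"

definition trace_at :: "(real^'n \<Rightarrow> real^'n) set \<Rightarrow> real^'n \<Rightarrow> (real^'n) set" where
  "trace_at W \<theta> = span ((\<lambda>\<xi>. \<xi> \<theta>) ` W)"

text \<open>
  \<open>is_solution S \<xi> x0 J \<theta>\<close>: the curve \<open>\<theta>\<close> solves \<open>\<theta>' = \<xi>(\<theta>)\<close>, \<open>\<theta> 0 = x0\<close> in \<open>S\<close> on the interval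
  \<open>J\<close> of nonnegative times. Values of \<open>\<theta>\<close> outside \<open>J\<close> are irrelevant; the derivative at time \<open>0\<close>
  is one-sided.
\<close>

definition is_solution ::
    "(real^'n) set \<Rightarrow> (real^'n \<Rightarrow> real^'n) \<Rightarrow> real^'n \<Rightarrow> real set \<Rightarrow> (real \<Rightarrow> real^'n) \<Rightarrow> bool" where
  "is_solution S \<xi> x0 J \<theta> \<longleftrightarrow>
     is_interval J \<and> 0 \<in> J \<and> J \<subseteq> {0..} \<and> \<theta> 0 = x0 \<and> \<theta> ` J \<subseteq> S \<and>
     (\<forall>t\<in>J. (\<theta> has_vector_derivative \<xi> (\<theta> t)) (at t within J))"

definition is_maximal_solution ::
    "(real^'n) set \<Rightarrow> (real^'n \<Rightarrow> real^'n) \<Rightarrow> real^'n \<Rightarrow> real set \<Rightarrow> (real \<Rightarrow> real^'n) \<Rightarrow> bool" where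
  "is_maximal_solution S \<xi> x0 J \<theta> \<longleftrightarrow>
     is_solution S \<xi> x0 J \<theta> \<and>
     (\<forall>J' \<theta>'. is_solution S \<xi> x0 J' \<theta>' \<and> J \<subseteq> J' \<and> (\<forall>t\<in>J. \<theta>' t = \<theta> t) \<longrightarrow> J' = J)"

text \<open>
  For \<open>C^1\<close> fields on open sets the maximal solution exists and is unique on its interval, so
  quantifying over all maximal solutions refers to that one.
\<close>

definition conserved_through ::
    "(real^'n) set \<Rightarrow> (real^'n \<Rightarrow> real^'n) set \<Rightarrow> (real^'n \<Rightarrow> real) \<Rightarrow> bool" where
  "conserved_through S W h \<longleftrightarrow>
     (\<forall>\<xi>\<in>W. \<forall>x0\<in>S. \<forall>J \<theta>. is_maximal_solution S \<xi> x0 J \<theta> \<longrightarrow>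
        (\<lambda>t. h (\<theta> t)) constant_on J)"

definition conservation_law ::
    "(real^'n) set \<Rightarrow> (real^'n \<Rightarrow> real^'d) \<Rightarrow> (real^'n) set \<Rightarrow> (real^'n \<Rightarrow> real) \<Rightarrow> bool" where
  "conservation_law \<Omega> \<phi> \<Omega>' h \<longleftrightarrow>
     conserved_through \<Omega>' ((\<lambda>\<xi>. restrict \<xi> \<Omega>') ` W_space \<Omega> \<phi>) h"

text \<open>
  Injectivity is needed because the gradients form an indexed family, whereas
  \<^const>\<open>independent\<close> is about sets. The family is \<open>h 0, \<dots>, h (N - 1)\<close>.
\<close>

definition independent_conservation_laws ::
    "(real^'n) set \<Rightarrow> (real^'n \<Rightarrow> real^'d) \<Rightarrow> (real^'n) set \<Rightarrow> nat \<Rightarrow> (nat \<Rightarrow> real^'n \<Rightarrow> real) \<Rightarrow> bool"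
    where
  "independent_conservation_laws \<Omega> \<phi> \<Omega>' N h \<longleftrightarrow>
     (\<forall>i<N. Ck_on 1 \<Omega>' (h i) \<and> conservation_law \<Omega> \<phi> \<Omega>' (h i)) \<and>
     (\<forall>\<theta>\<in>\<Omega>'. inj_on (\<lambda>i. grad (h i) \<theta>) {..<N} \<and> independent ((\<lambda>i. grad (h i) \<theta>) ` {..<N}))"

end

theory Submission
  imports Defs
begin

text \<open>
  Upper bound: a \<open>C\<^sup>1\<close> conserved function \<open>h\<close> is annihilated by every field in \<open>W\<^sub>\<phi>\<close>, and the fields
  annihilating it form a Lie subalgebra, so the gradients of independent conservation laws lie in
  the orthogonal complement of the trace of \<open>Lie(W\<^sub>\<phi>)\<close>.

  Existence is the Frobenius theorem. Constancy of the rank yields linear maps \<open>B(\<theta>)\<close> onto the trace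
  at \<open>\<theta>\<close>, restricting to the identity there, such that the fields \<open>B(\<cdot>) a\<close> commute. Follow the
  solution of \<open>\<gamma>' = - B(\<gamma>) (y - \<theta>0)\<close>, \<open>\<gamma>(0) = y\<close> and let \<open>H(y) = \<gamma>(1)\<close>. This \<open>H\<close> is \<open>C\<^sup>1\<close>, and the
  solution of the variational equation in a direction \<open>k\<close> of the trace at \<open>y\<close> is
  \<open>(1 - t) B(\<gamma>(t)) k\<close>, so \<open>dH(y) k = 0\<close>. The components of \<open>H\<close> orthogonal to the trace at \<open>\<theta>0\<close> are
  the conservation laws.
\<close>

section \<open>Calculus of \<open>C\<^sup>k\<close> functions\<close>

text \<open>The curve \<gamma> is a projection in disguise. Let \<open>P\<close> be the orthogonal
  projection onto the trace at \<theta>0. The frame is built so that \<open>P (B y a) = P a\<close>;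
  hence, while \<gamma> runs inside the leaf of y, its image under \<open>P\<close> runs straight
  from \<open>P y\<close> to \<open>P \<theta>0\<close> in unit time, and H(y) is the point where
  the leaf meets the slice through \<theta>0 orthogonal to the trace. Putting y into the speed as
  well as into the initial value replaces the usual composition of flows by one autonomous equation
  for each y. The price is that y is an initial value and a parameter at once; differentiability in
  y comes from explicit estimates on a ball so small that the equations have Lipschitz constant at
  most 1/2 over unit time. Two obstacles remain. Conservation is a statement about maximal
  solutions, so the pointwise condition is reached only after extending short solutions. And
  independence is required at every point of the neighborhood, so the gradients, orthonormal at
  \<theta>0, must be kept close to their values there.\<close>

lemma Ck_on_cong:
  assumes "open S" "\<And>x. x \<in> S \<Longrightarrow> f x = g x" "Ck_on k S f"
  shows "Ck_on k S g"
  using assms(2,3)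
proof (induction k arbitrary: f g)
  case 0
  then show ?case by (simp cong: continuous_on_cong)
next
  case (Suc k)
  have "g differentiable (at x) \<and> frechet_derivative f (at x) = frechet_derivative g (at x)"
    if "x \<in> S" for x
  proof -
    have "(f has_derivative frechet_derivative f (at x)) (at x)"
      using Suc.prems(2) that by (auto simp: frechet_derivative_works)
    then have "(g has_derivative frechet_derivative f (at x)) (at x)"
      using has_derivative_transform_within_open[OF _ \<open>open S\<close> that] Suc.prems(1) by blast
    then show ?thesis
      using frechet_derivative_at by (auto simp: differentiable_def)
  qed
  moreover have "Ck_on k S (\<lambda>x. frechet_derivative g (at x) v)" for v
    by (rule Suc.IH[of "\<lambda>x. frechet_derivative f (at x) v"]) (use Suc.prems calculation in auto)
  ultimately show ?case by simp
qed

lemma Ck_on_SucI: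
  assumes "open S" "\<And>x. x \<in> S \<Longrightarrow> (f has_derivative f' x) (at x)" "\<And>v. Ck_on k S (\<lambda>x. f' x v)"
  shows "Ck_on (Suc k) S f"
proof -
  have "f' x = frechet_derivative f (at x)" if "x \<in> S" for x
    using assms(2)[OF that] by (rule frechet_derivative_at)
  then have "Ck_on k S (\<lambda>x. frechet_derivative f (at x) v)" for v
    by (intro Ck_on_cong[OF assms(1) _ assms(3)]) simp
  then show ?thesis
    using assms(2) by (auto simp: differentiable_def)
qed

lemma Ck_on_has_derivative:
  assumes "Ck_on (Suc k) S f" "x \<in> S"
  shows "(f has_derivative frechet_derivative f (at x)) (at x)"
  using assms by (simp add: frechet_derivative_works)

lemma Ck_on_Suc_imp: "Ck_on (Suc k) S f \<Longrightarrow> Ck_on k S f"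
proof (induction k arbitrary: f)
  case 0
  then show ?case
    by (auto simp: intro!: continuous_at_imp_continuous_on differentiable_imp_continuous_within)
qed auto

lemma Ck_on_mono:
  assumes "Ck_on l S f" "k \<le> l"
  shows "Ck_on k S f"
  using assms(2,1) by (induction rule: dec_induct) (blast intro: Ck_on_Suc_imp)+

lemma Ck_on_imp_continuous_on: "Ck_on k S f \<Longrightarrow> continuous_on S f"
  using Ck_on_mono[of k S f 0] by simp

lemma Ck_on_subset:
  assumes "Ck_on k S f" "T \<subseteq> S"
  shows "Ck_on k T f"
  using assms by (induction k arbitrary: f) (auto intro: continuous_on_subset)

lemma Ck_on_const: "open S \<Longrightarrow> Ck_on k S (\<lambda>x. c)"
proof (induction k arbitrary: c)
  case (Suc k)
  show ?case
    by (rule Ck_on_SucI[where f'="\<lambda>_ _. 0"]) (use Suc in auto)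
qed simp

lemma Ck_on_bounded_linear:
  assumes "bounded_linear L" "open S" "Ck_on k S f"
  shows "Ck_on k S (\<lambda>x. L (f x))"
  using assms(3)
proof (induction k arbitrary: f)
  case 0
  then show ?case
    using bounded_linear.continuous_on[OF assms(1)] by simp
next
  case (Suc k)
  show ?case
    by (rule Ck_on_SucI[OF \<open>open S\<close> bounded_linear.has_derivative[OF assms(1) Ck_on_has_derivative]])
      (use Suc in auto)
qed

lemma Ck_on_add:
  assumes "open S" "Ck_on k S f" "Ck_on k S g"
  shows "Ck_on k S (\<lambda>x. f x + g x)"
  using assms(2,3)
proof (induction k arbitrary: f g)
  case 0
  then show ?case by (simp add: continuous_on_add)
next
  case (Suc k)
  show ?case
    by (rule Ck_on_SucI[OF \<open>open S\<close> has_derivative_add[OF Ck_on_has_derivative Ck_on_has_derivative]])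
      (use Suc in auto)
qed

lemma Ck_on_sum:
  assumes "open S" "\<And>i. i \<in> I \<Longrightarrow> Ck_on k S (f i)"
  shows "Ck_on k S (\<lambda>x. \<Sum>i\<in>I. f i x)"
  using assms(2)
  by (induction I rule: infinite_finite_induct) (auto intro: Ck_on_add Ck_on_const assms(1))

lemma Ck_on_bilinear:
  assumes "bounded_bilinear B" "open S" "Ck_on k S f" "Ck_on k S g"
  shows "Ck_on k S (\<lambda>x. B (f x) (g x))"
  using assms(3,4)
proof (induction k arbitrary: f g)
  case 0
  then show ?case
    using bounded_bilinear.continuous_on[OF assms(1)] by simp
next
  case (Suc k)
  then have "Ck_on k S f" "Ck_on k S g"
    by (auto intro: Ck_on_Suc_imp)
  then show ?case
    by (intro Ck_on_SucI[OF \<open>open S\<close>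
          bounded_bilinear.FDERIV[OF assms(1) Ck_on_has_derivative Ck_on_has_derivative]])
      (use Suc in \<open>auto intro!: Ck_on_add assms(2)\<close>)
qed

lemmas Ck_on_scaleR = Ck_on_bilinear[OF bounded_bilinear_scaleR]
lemmas Ck_on_mult = Ck_on_bilinear[OF bounded_bilinear_mult]

lemma Ck_on_prod:
  fixes f :: "'i \<Rightarrow> 'a::real_normed_vector \<Rightarrow> 'b::{real_normed_algebra,comm_ring_1}"
  assumes "open S" "\<And>i. i \<in> I \<Longrightarrow> Ck_on k S (f i)"
  shows "Ck_on k S (\<lambda>x. \<Prod>i\<in>I. f i x)"
  using assms(2)
  by (induction I rule: infinite_finite_induct) (auto intro: Ck_on_mult Ck_on_const assms(1))

text \<open>The derivative \<open>- inverse f * df * inverse f\<close> contains the inverse itself,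
  but one order lower, so the induction on \<open>k\<close> closes.\<close>

lemma Ck_on_inverse:
  fixes f :: "'a::real_normed_vector \<Rightarrow> real"
  assumes "open S" "Ck_on k S f" "\<And>x. x \<in> S \<Longrightarrow> f x \<noteq> 0"
  shows "Ck_on k S (\<lambda>x. inverse (f x))"
  using assms(2)
proof (induction k)
  case 0
  then show ?case
    using assms(3) by (simp add: continuous_on_inverse)
next
  case (Suc k)
  then have inv: "Ck_on k S (\<lambda>x. inverse (f x))"
    by (blast intro: Ck_on_Suc_imp)
  have *: "((\<lambda>x. inverse (f x)) has_derivative
      (\<lambda>v. - 1 *\<^sub>R (inverse (f x) * frechet_derivative f (at x) v * inverse (f x)))) (at x)"
    if "x \<in> S" for x
    using Deriv.has_derivative_inverse[OF assms(3)[OF that] Ck_on_has_derivative[OF Suc.prems that]] by simp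
  show ?case
    by (rule Ck_on_SucI[OF assms(1) *], assumption,
        intro Ck_on_bounded_linear[OF bounded_linear_scaleR_right] Ck_on_mult assms(1) inv)
      (use Suc.prems in auto)
qed

lemma Ck_on_vec:
  fixes f :: "'a::real_normed_vector \<Rightarrow> real^'n"
  assumes "open S" "\<And>i. Ck_on k S (\<lambda>x. f x $ i)"
  shows "Ck_on k S f"
proof -
  have "Ck_on k S (\<lambda>x. \<Sum>i\<in>UNIV. f x $ i *\<^sub>R axis i 1)"
    by (intro Ck_on_sum Ck_on_scaleR Ck_on_const assms)
  then show ?thesis
    by (rule Ck_on_cong[OF assms(1), rotated]) (simp add: basis_expansion flip: scalar_mult_eq_scaleR)
qed

lemma Ck_on_vec_nth:
  fixes f :: "'a::real_normed_vector \<Rightarrow> real^'n"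
  assumes "open S" "Ck_on k S f"
  shows "Ck_on k S (\<lambda>x. f x $ i)"
  using Ck_on_bounded_linear[OF bounded_linear_vec_nth assms] .

lemma Ck_on_frechet_derivative: "Ck_on (Suc k) S f \<Longrightarrow> Ck_on k S (\<lambda>x. frechet_derivative f (at x) v)"
  by simp

section \<open>Gradients, Jacobians and derivatives in coordinates\<close>

lemma vec_expansion: "(\<Sum>j\<in>UNIV. v $ j *\<^sub>R axis j 1) = (v :: real^'n)"
  by (simp add: basis_expansion flip: scalar_mult_eq_scaleR)

lemma frechet_derivative_expansion:
  fixes f :: "real^'n \<Rightarrow> 'b::real_normed_vector"
  assumes "f differentiable (at x)"
  shows "frechet_derivative f (at x) v = (\<Sum>j\<in>UNIV. v $ j *\<^sub>R frechet_derivative f (at x) (axis j 1))"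
proof -
  interpret linear "frechet_derivative f (at x)"
    by (rule linear_frechet_derivative[OF assms])
  have "frechet_derivative f (at x) (\<Sum>j\<in>UNIV. v $ j *\<^sub>R axis j 1) =
      (\<Sum>j\<in>UNIV. v $ j *\<^sub>R frechet_derivative f (at x) (axis j 1))"
    by (simp only: sum scale)
  then show ?thesis
    by (simp only: vec_expansion)
qed

lemma grad_inner:
  assumes "f differentiable (at x)"
  shows "grad f x \<bullet> v = frechet_derivative f (at x) v"
  by (subst frechet_derivative_expansion[OF assms]) (simp add: grad_def inner_vec_def mult.commute)

lemma jacobian_mult:
  fixes f :: "real^'n \<Rightarrow> real^'m"
  assumes "f differentiable (at x)"
  shows "jacobian f (at x) *v v = frechet_derivative f (at x) v"
  using frechet_derivative_at[OF assms[unfolded jacobian_works]] by metis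

text \<open>\<open>Ck_on\<close> speaks of derivatives in fixed directions; the varying direction
  \<open>g x\<close> is expanded in the standard basis. This is the form in which brackets
  occur.\<close>

lemma Ck_on_frechet_derivative_field:
  fixes f :: "real^'n \<Rightarrow> 'b::real_normed_vector"
  assumes "open S" "Ck_on (Suc k) S f" "Ck_on k S g"
  shows "Ck_on k S (\<lambda>x. frechet_derivative f (at x) (g x))"
proof (rule Ck_on_cong[OF assms(1)])
  show "Ck_on k S (\<lambda>x. \<Sum>j\<in>UNIV. g x $ j *\<^sub>R frechet_derivative f (at x) (axis j 1))"
    by (intro Ck_on_sum Ck_on_scaleR Ck_on_vec_nth assms Ck_on_frechet_derivative)
  fix x assume "x \<in> S"
  then show "(\<Sum>j\<in>UNIV. g x $ j *\<^sub>R frechet_derivative f (at x) (axis j 1)) = frechet_derivative f (at x) (g x)"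
    using assms(2) by (simp add: frechet_derivative_expansion[symmetric])
qed

lemma Ck_on_diff:
  assumes "open S" "Ck_on k S f" "Ck_on k S g"
  shows "Ck_on k S (\<lambda>x. f x - g x)"
  using Ck_on_add[OF assms(1,2) Ck_on_bounded_linear[OF bounded_linear_minus[OF bounded_linear_ident] assms(1,3)]]
  by simp

lemma smooth_on_Ck: "smooth_on S f \<Longrightarrow> Ck_on k S f"
  by (simp add: smooth_on_def)

section \<open>Smooth fields and the generated Lie algebra\<close>

lemma Ck_on_restrict:
  assumes "open S"
  shows "Ck_on k S (restrict f S) \<longleftrightarrow> Ck_on k S f"
  by (auto intro: Ck_on_cong[OF assms, rotated])

lemma lie_subalgebra_smooth_fields:
  fixes \<Omega> :: "(real^'n) set"
  assumes "open \<Omega>"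
  shows "lie_subalgebra \<Omega> (smooth_fields \<Omega>)"
proof -
  have "Ck_on k \<Omega> (\<lambda>\<theta>. jacobian f (at \<theta>) *v g \<theta> - jacobian g (at \<theta>) *v f \<theta>)"
    if "smooth_on \<Omega> f" "smooth_on \<Omega> g" for f g :: "real^'n \<Rightarrow> real^'n" and k
  proof (rule Ck_on_cong[OF assms])
    show "Ck_on k \<Omega> (\<lambda>\<theta>. frechet_derivative f (at \<theta>) (g \<theta>) - frechet_derivative g (at \<theta>) (f \<theta>))"
      by (intro Ck_on_diff Ck_on_frechet_derivative_field assms smooth_on_Ck that)
    show "frechet_derivative f (at \<theta>) (g \<theta>) - frechet_derivative g (at \<theta>) (f \<theta>) =
        jacobian f (at \<theta>) *v g \<theta> - jacobian g (at \<theta>) *v f \<theta>" if "\<theta> \<in> \<Omega>" for \<theta>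
      using \<open>smooth_on \<Omega> f\<close>[THEN smooth_on_Ck, of "Suc 0"] \<open>smooth_on \<Omega> g\<close>[THEN smooth_on_Ck, of "Suc 0"] that
      by (simp add: jacobian_mult)
  qed
  then show ?thesis
    unfolding lie_subalgebra_def lie_bracket_def smooth_fields_def
    by (auto simp: smooth_on_def Ck_on_restrict[OF assms]
        intro!: Ck_on_const Ck_on_add Ck_on_bounded_linear[OF bounded_linear_scaleR_right] assms)
qed

lemma W_space_subset_smooth_fields:
  fixes \<phi> :: "real^'n \<Rightarrow> real^'d"
  assumes "open \<Omega>" "smooth_on \<Omega> \<phi>"
  shows "W_space \<Omega> \<phi> \<subseteq> smooth_fields \<Omega>"
proof -
  have "Ck_on k \<Omega> (grad (\<lambda>x. \<phi> x $ i))" for k i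
    unfolding grad_def[abs_def]
    by (rule Ck_on_vec[OF assms(1)], simp,
        intro Ck_on_frechet_derivative Ck_on_vec_nth assms smooth_on_Ck)
  then show ?thesis
    unfolding W_space_def smooth_fields_def
    by (auto simp: smooth_on_def Ck_on_restrict[OF assms(1)]
        intro!: Ck_on_sum Ck_on_bounded_linear[OF bounded_linear_scaleR_right] assms)
qed

text \<open>The closure conditions pass to intersections. Containment in
  \<open>smooth_fields \<Omega>\<close> needs at least one Lie subalgebra above \<open>W\<close>,
  since an empty intersection would be the set of all functions;
  \<open>smooth_fields \<Omega>\<close> itself is one.\<close>

lemma lie_subalgebra_Lie:
  fixes \<Omega> :: "(real^'n) set"
  assumes "open \<Omega>" "W \<subseteq> smooth_fields \<Omega>"
  shows "lie_subalgebra \<Omega> (Lie \<Omega> W)"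
proof -
  have "Lie \<Omega> W \<subseteq> smooth_fields \<Omega>"
    unfolding Lie_def using assms lie_subalgebra_smooth_fields by (intro hull_minimal)
  moreover have mem: "\<xi> \<in> Lie \<Omega> W \<longleftrightarrow> (\<forall>L. W \<subseteq> L \<and> lie_subalgebra \<Omega> L \<longrightarrow> \<xi> \<in> L)" for \<xi>
    by (auto simp: Lie_def hull_def)
  moreover have "(\<lambda>\<theta>\<in>\<Omega>. 0) \<in> Lie \<Omega> W"
    by (simp add: mem lie_subalgebra_def)
  moreover have "(\<lambda>\<theta>\<in>\<Omega>. \<xi>1 \<theta> + \<xi>2 \<theta>) \<in> Lie \<Omega> W" if "\<xi>1 \<in> Lie \<Omega> W" "\<xi>2 \<in> Lie \<Omega> W" for \<xi>1 \<xi>2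
    using that by (simp add: mem lie_subalgebra_def)
  moreover have "(\<lambda>\<theta>\<in>\<Omega>. c *\<^sub>R \<xi> \<theta>) \<in> Lie \<Omega> W" if "\<xi> \<in> Lie \<Omega> W" for c \<xi>
    using that by (simp add: mem lie_subalgebra_def)
  moreover have "lie_bracket \<Omega> \<xi>1 \<xi>2 \<in> Lie \<Omega> W" if "\<xi>1 \<in> Lie \<Omega> W" "\<xi>2 \<in> Lie \<Omega> W" for \<xi>1 \<xi>2
    using that by (simp add: mem lie_subalgebra_def)
  ultimately show ?thesis
    by (simp add: lie_subalgebra_def)
qed

section \<open>Picard iteration and stability on the unit interval\<close>

text \<open>The constants are tuned to unit time: Lipschitz constant 1/2 makes the integral operator
  a contraction by 1/2 in the supremum norm, and a field bounded by \<open>r\<close> moves a point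
  by at most \<open>r\<close>. Other equations are scaled to fit.\<close>

lemma picard:
  fixes F :: "'a::euclidean_space \<Rightarrow> 'a"
  assumes S: "closed S" "convex S"
    and lip: "\<And>x y. x \<in> S \<Longrightarrow> y \<in> S \<Longrightarrow> norm (F x - F y) \<le> norm (x - y) / 2"
    and bnd: "\<And>x. x \<in> S \<Longrightarrow> norm (F x) \<le> r"
    and ball: "cball u0 r \<subseteq> S" and "0 \<le> r"
  obtains u where "u 0 = u0" "\<And>t. t \<in> {0..1} \<Longrightarrow> u t \<in> cball u0 r"
    "\<And>t. t \<in> {0..1} \<Longrightarrow> (u has_vector_derivative F (u t)) (at t within {0..1})"
proof -
  have "S \<noteq> {}"
    using ball \<open>0 \<le> r\<close> by force
  \<comment> \<open>Precomposition with the metric projection makes the Lipschitz bound global.\<close>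
  define G where "G x = F (closest_point S x)" for x
  have cp: "closest_point S x \<in> S" for x
    by (rule closest_point_in_set[OF S(1) \<open>S \<noteq> {}\<close>])
  have Glip: "dist (G x) (G y) \<le> dist x y / 2" for x y
    unfolding G_def using lip[OF cp cp, of x y] closest_point_lipschitz[OF S(2,1) \<open>S \<noteq> {}\<close>, of x y]
    by (simp add: dist_norm)
  have Gbnd: "norm (G x) \<le> r" for x
    using bnd[OF cp] by (simp add: G_def)
  have Gcont: "continuous_on A G" for A
  proof (rule lipschitz_on_continuous_on)
    show "(1/2)-lipschitz_on A G"
      using Glip by (intro lipschitz_onI) auto
  qed
  \<comment> \<open>Clamping time to \<open>{0..1}\<close> turns the iterates into bounded
    continuous functions on the whole line, where the type of bounded continuous functions supplies
    completeness.\<close>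
  define c :: "real \<Rightarrow> real" where "c t = max 0 (min 1 t)" for t
  have c: "c t \<in> {0..1}" for t by (auto simp: c_def)
  have Ggcont: "continuous_on A (\<lambda>s. G (apply_bcontfun g s))" for A and g :: "real \<Rightarrow>\<^sub>C 'a"
    by (rule continuous_on_compose2[OF Gcont[of UNIV] continuous_on_apply_bcontfun]) auto
  have ib: "norm (integral {0..c t} h) \<le> B"
    if "continuous_on UNIV h" "\<And>s. norm (h s) \<le> B" for h :: "real \<Rightarrow> 'a" and B t
  proof -
    have "norm (integral {0..c t} h) \<le> B * (c t - 0)"
      using c[of t] that by (intro integral_bound) (auto intro: continuous_on_subset)
    also have "\<dots> \<le> B * 1"
      using c[of t] order_trans[OF norm_ge_zero that(2)] by (intro mult_left_mono) auto
    finally show ?thesis by simp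
  qed
  have ibg: "norm (integral {0..c t} (\<lambda>s. G (apply_bcontfun g s))) \<le> r" for g t
    by (rule ib[OF Ggcont Gbnd])
  define T where "T g t = u0 + integral {0..c t} (\<lambda>s. G (apply_bcontfun g s))" for g t
  have Tb: "T g \<in> bcontfun" for g
  proof -
    have "continuous_on {0..1} (\<lambda>t. integral {0..t} (\<lambda>s. G (apply_bcontfun g s)))"
      by (intro indefinite_integral_continuous_1 integrable_continuous_interval Ggcont)
    moreover have "continuous_on UNIV c"
      unfolding c_def by (intro continuous_intros)
    ultimately have "continuous_on UNIV (\<lambda>t. integral {0..c t} (\<lambda>s. G (apply_bcontfun g s)))"
      by (rule continuous_on_compose2) (use c in auto)
    moreover have "norm (T g t) \<le> norm u0 + r" for t
      unfolding T_def by (rule order_trans[OF norm_triangle_ineq add_left_mono[OF ibg]])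
    ultimately show ?thesis
      unfolding bcontfun_def T_def by (auto intro!: continuous_intros simp: bounded_iff)
  qed
  have "\<exists>!g. Bcontfun (T g) = g"
  proof (rule banach_fix_type[of "1/2"])
    show "\<forall>g h. dist (Bcontfun (T g)) (Bcontfun (T h)) \<le> 1 / 2 * dist g h"
    proof (intro allI dist_bound)
      fix g h t
      have "T g t - T h t = integral {0..c t} (\<lambda>s. G (apply_bcontfun g s) - G (apply_bcontfun h s))"
        unfolding T_def
        by (simp add: Henstock_Kurzweil_Integration.integral_diff integrable_continuous_interval Ggcont)
      moreover have "norm \<dots> \<le> dist g h / 2"
      proof (rule ib)
        show "continuous_on UNIV (\<lambda>s. G (apply_bcontfun g s) - G (apply_bcontfun h s))"
          by (intro continuous_intros Ggcont)
        show "norm (G (apply_bcontfun g s) - G (apply_bcontfun h s)) \<le> dist g h / 2" for s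
          using Glip[of "apply_bcontfun g s" "apply_bcontfun h s"]
            dist_bounded[of g s h] by (simp add: dist_norm)
      qed
      ultimately show "dist (apply_bcontfun (Bcontfun (T g)) t) (apply_bcontfun (Bcontfun (T h)) t) \<le> 1 / 2 * dist g h"
        by (simp add: Bcontfun_inverse Tb dist_norm)
    qed
  qed auto
  then obtain g where "Bcontfun (T g) = g" by auto
  then have g: "apply_bcontfun g = T g"
    using Bcontfun_inverse[OF Tb] by metis
  define u where "u = apply_bcontfun g"
  have u: "u t = u0 + integral {0..t} (\<lambda>s. G (u s))" if "t \<in> {0..1}" for t
    using that unfolding u_def by (subst g) (simp add: T_def c_def)
  have ub: "u t \<in> cball u0 r" if "t \<in> {0..1}" for t
    using ibg[of t g] unfolding u_def by (subst g) (simp add: T_def dist_norm)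
  have "(u has_vector_derivative F (u t)) (at t within {0..1})" if t: "t \<in> {0..1}" for t
  proof -
    have "((\<lambda>t. u0 + integral {0..t} (\<lambda>s. G (u s))) has_vector_derivative 0 + G (u t)) (at t within {0..1})"
      using t Ggcont by (intro has_vector_derivative_add has_vector_derivative_const
          integral_has_vector_derivative) (auto simp: u_def)
    then have "(u has_vector_derivative G (u t)) (at t within {0..1})"
      using has_vector_derivative_transform[of t "{0..1}" u, OF t] u by auto
    \<comment> \<open>Confinement to the ball makes the metric projection the identity along
      \<open>u\<close>, so \<open>G\<close> may be replaced by \<open>F\<close> again.\<close>
    moreover have "u t \<in> S"
      using ub[OF t] ball by auto
    ultimately show ?thesis
      by (simp add: G_def closest_point_self)
  qed
  moreover have "u 0 = u0"
    using u[of 0] by simp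
  ultimately show ?thesis
    using ub that by blast
qed

text \<open>No exponential appears: at a time \<open>s\<close> where \<open>norm (d s)\<close> is
  largest, the mean value inequality gives
  \<open>norm (d s) \<le> norm (d 0) + norm (d s) / 2 + \<eta>\<close>, and half of the left side
  absorbs the middle term.\<close>

lemma short_time_gronwall:
  fixes d :: "real \<Rightarrow> 'a::real_normed_vector"
  assumes der: "\<And>t. t \<in> {0..1} \<Longrightarrow> (d has_vector_derivative d' t) (at t within {0..1})"
    and le: "\<And>t. t \<in> {0..1} \<Longrightarrow> norm (d' t) \<le> norm (d t) / 2 + \<eta>"
    and "t \<in> {0..1}"
  shows "norm (d t) \<le> 2 * (norm (d 0) + \<eta>)"
proof -
  have "continuous_on {0..1} d"
    using der has_vector_derivative_continuous continuous_on_eq_continuous_within by blast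
  then have "continuous_on {0..1} (\<lambda>t. norm (d t))"
    by (rule continuous_on_norm)
  then obtain s where s: "s \<in> {0..1}" "\<And>t. t \<in> {0..1} \<Longrightarrow> norm (d t) \<le> norm (d s)"
    using continuous_attains_sup[of "{0..1::real}" "\<lambda>t. norm (d t)"] by auto
  have bnd: "norm (d' t) \<le> norm (d s) / 2 + \<eta>" if "t \<in> {0..1}" for t
    using le[OF that] s(2)[OF that] by simp
  have "norm (d s - d 0) \<le> (norm (d s) / 2 + \<eta>) * norm (s - 0)"
  proof (rule differentiable_bound[of "{0..1}" d "\<lambda>t h. h *\<^sub>R d' t"])
    show "onorm (\<lambda>h. h *\<^sub>R d' t) \<le> norm (d s) / 2 + \<eta>" if "t \<in> {0..1}" for t
      using bnd[OF that] order_trans[OF norm_ge_zero bnd[OF that]]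
      by (intro onorm_bound) (simp_all add: mult.commute[of _ "norm (d s) / 2 + \<eta>"] mult.commute[of _ "norm (d' t)"] mult_right_mono)
  qed (use der s in \<open>auto simp: has_vector_derivative_def\<close>)
  also have "\<dots> \<le> norm (d s) / 2 + \<eta>"
    using s(1) order_trans[OF norm_ge_zero bnd[OF s(1)]] by (simp add: mult_left_le)
  finally have "norm (d s) \<le> norm (d 0) + (norm (d s) / 2 + \<eta>)"
    using norm_triangle_sub[of "d s" "d 0"] by simp
  then show ?thesis
    using s(2)[OF \<open>t \<in> {0..1}\<close>] by simp
qed

section \<open>Solutions and conserved functions\<close>

text \<open>Compactness bounds the derivative on each basis vector, linearity on all directions, and
  convexity of \<open>K\<close> turns this into a Lipschitz bound. A single \<open>L\<close> serves
  for all three; it is taken at least 1 so that it may be divided by.\<close>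

lemma Ck_on_1_bounds:
  fixes f :: "real^'n \<Rightarrow> 'b::real_normed_vector"
  assumes "Ck_on (Suc 0) S f" "compact K" "convex K" "K \<subseteq> S"
  obtains L where "L > 0" "\<And>x. x \<in> K \<Longrightarrow> norm (f x) \<le> L"
    "\<And>x v. x \<in> K \<Longrightarrow> norm (frechet_derivative f (at x) v) \<le> L * norm v"
    "\<And>x y. x \<in> K \<Longrightarrow> y \<in> K \<Longrightarrow> norm (f x - f y) \<le> L * norm (x - y)"
proof -
  have bdd: "\<exists>C. \<forall>x\<in>K. norm (g x) \<le> C" if "continuous_on S g" for g :: "real^'n \<Rightarrow> 'b"
    using compact_imp_bounded[OF compact_continuous_image[OF continuous_on_subset[OF that \<open>K \<subseteq> S\<close>] \<open>compact K\<close>]]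
    by (auto simp: bounded_iff)
  have "continuous_on S (\<lambda>x. frechet_derivative f (at x) v)" for v
    using assms(1) by simp
  then have "\<forall>j. \<exists>C. \<forall>x\<in>K. norm (frechet_derivative f (at x) (axis j 1)) \<le> C"
    by (intro allI bdd)
  then obtain C where C: "\<And>j x. x \<in> K \<Longrightarrow> norm (frechet_derivative f (at x) (axis j 1)) \<le> C j"
    by metis
  obtain C0 where C0: "\<And>x. x \<in> K \<Longrightarrow> norm (f x) \<le> C0"
    using bdd[OF Ck_on_imp_continuous_on[OF assms(1)]] by blast
  define L where "L = max 1 (max C0 (\<Sum>j\<in>UNIV. C j))"
  have der: "norm (frechet_derivative f (at x) v) \<le> L * norm v" if "x \<in> K" for x v
  proof -
    have "f differentiable (at x)"
      using assms that by auto
    then have "norm (frechet_derivative f (at x) v) \<le>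
        (\<Sum>j\<in>UNIV. norm (v $ j *\<^sub>R frechet_derivative f (at x) (axis j 1)))"
      by (subst frechet_derivative_expansion) (auto simp del: norm_scaleR intro: norm_sum)
    also have "\<dots> \<le> (\<Sum>j\<in>UNIV. norm v * C j)"
      using C[OF that] component_le_norm_cart[of v] by (intro sum_mono) (simp add: mult_mono)
    also have "\<dots> \<le> L * norm v"
      unfolding L_def by (subst mult.commute, simp add: sum_distrib_left[symmetric] mult_left_mono)
    finally show ?thesis .
  qed
  show ?thesis
  proof (rule that[of L])
    show "L > 0" by (simp add: L_def)
    show "norm (f x) \<le> L" if "x \<in> K" for x
      using C0[OF that] by (simp add: L_def)
    show "norm (f x - f y) \<le> L * norm (x - y)" if "x \<in> K" "y \<in> K" for x y
    proof (rule differentiable_bound[OF \<open>convex K\<close> _ _ that])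
      show "(f has_derivative frechet_derivative f (at x)) (at x within K)" if "x \<in> K" for x
        using Ck_on_has_derivative[OF assms(1)] that assms(4) has_derivative_at_withinI by blast
      show "onorm (frechet_derivative f (at x)) \<le> L" if "x \<in> K" for x
        using der[OF that] \<open>L > 0\<close> by (intro onorm_bound) auto
    qed
  qed (rule der)
qed

lemma local_solution:
  assumes "open S" "Ck_on (Suc 0) S \<xi>" "x0 \<in> S"
  obtains \<epsilon> u where "\<epsilon> > 0" "is_solution S \<xi> x0 {0..\<epsilon>} u"
proof -
  obtain \<rho> where \<rho>: "\<rho> > 0" "cball x0 \<rho> \<subseteq> S"
    using assms open_contains_cball by blast
  obtain L where L: "L > 0" "\<And>x. x \<in> cball x0 \<rho> \<Longrightarrow> norm (\<xi> x) \<le> L"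
    "\<And>x y. x \<in> cball x0 \<rho> \<Longrightarrow> y \<in> cball x0 \<rho> \<Longrightarrow> norm (\<xi> x - \<xi> y) \<le> L * norm (x - y)"
    using Ck_on_1_bounds[OF assms(2) compact_cball convex_cball \<rho>(2)] by metis
  \<comment> \<open>Time is rescaled: on \<open>{0..1}\<close> the field
    \<open>\<epsilon> *\<^sub>R \<xi> x\<close> is bounded by
    \<open>\<epsilon> * L \<le> \<rho>\<close> and has Lipschitz constant
    \<open>\<epsilon> * L \<le> 1 / 2\<close>, as \<open>picard\<close> demands.\<close>
  define \<epsilon> where "\<epsilon> = min (\<rho> / L) (1 / (2 * L))"
  have \<epsilon>: "\<epsilon> > 0" "\<epsilon> * L \<le> \<rho>" "\<epsilon> * L \<le> 1 / 2"
    using \<rho> L(1) by (auto simp: \<epsilon>_def min_def field_simps)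
  obtain u where u: "u 0 = x0" "\<And>t. t \<in> {0..1} \<Longrightarrow> u t \<in> cball x0 \<rho>"
    "\<And>t. t \<in> {0..1} \<Longrightarrow> (u has_vector_derivative \<epsilon> *\<^sub>R \<xi> (u t)) (at t within {0..1})"
  proof (rule picard[of "cball x0 \<rho>" "\<lambda>x. \<epsilon> *\<^sub>R \<xi> x" \<rho> x0])
    show "norm (\<epsilon> *\<^sub>R \<xi> x - \<epsilon> *\<^sub>R \<xi> y) \<le> norm (x - y) / 2"
      if "x \<in> cball x0 \<rho>" "y \<in> cball x0 \<rho>" for x y
    proof -
      have "norm (\<epsilon> *\<^sub>R \<xi> x - \<epsilon> *\<^sub>R \<xi> y) = \<epsilon> * norm (\<xi> x - \<xi> y)"
        using \<epsilon>(1) by (simp flip: scaleR_diff_right)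
      also have "\<dots> \<le> (\<epsilon> * L) * norm (x - y)"
        using L(3)[OF that] \<epsilon>(1) by (simp add: mult.assoc)
      also have "\<dots> \<le> 1 / 2 * norm (x - y)"
        using \<epsilon>(3) by (rule mult_right_mono) simp
      finally show ?thesis by simp
    qed
    show "norm (\<epsilon> *\<^sub>R \<xi> x) \<le> \<rho>" if "x \<in> cball x0 \<rho>" for x
      using order_trans[OF mult_left_mono[OF L(2)[OF that], of \<epsilon>] \<epsilon>(2)] \<epsilon>(1) by simp
  qed (use \<rho> in auto)
  have "is_solution S \<xi> x0 {0..\<epsilon>} (\<lambda>t. u (t / \<epsilon>))"
    unfolding is_solution_def
  proof (intro conjI ballI)
    fix t assume t: "t \<in> {0..\<epsilon>}"
    have im: "(\<lambda>t. t / \<epsilon>) ` {0..\<epsilon>} \<subseteq> {0..1}"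
      using \<epsilon>(1) by auto
    have "(u \<circ> (\<lambda>t. t / \<epsilon>) has_vector_derivative (1 / \<epsilon>) *\<^sub>R \<epsilon> *\<^sub>R \<xi> (u (t / \<epsilon>))) (at t within {0..\<epsilon>})"
    proof (rule vector_diff_chain_within)
      show "((\<lambda>t. t / \<epsilon>) has_vector_derivative 1 / \<epsilon>) (at t within {0..\<epsilon>})"
        using \<epsilon>(1) by (auto intro!: derivative_eq_intros simp: has_vector_derivative_def)
      show "(u has_vector_derivative \<epsilon> *\<^sub>R \<xi> (u (t / \<epsilon>))) (at (t / \<epsilon>) within (\<lambda>t. t / \<epsilon>) ` {0..\<epsilon>})"
        using u(3) t im has_vector_derivative_within_subset by blast
    qed
    then show "((\<lambda>t. u (t / \<epsilon>)) has_vector_derivative \<xi> (u (t / \<epsilon>))) (at t within {0..\<epsilon>})"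
      using \<epsilon>(1) by (simp add: o_def)
  next
    show "(\<lambda>t. u (t / \<epsilon>)) ` {0..\<epsilon>} \<subseteq> S"
      using u(2) \<rho>(2) \<epsilon>(1) by (auto simp del: mem_cball intro!: subsetD[OF \<rho>(2)])
  qed (use u \<epsilon>(1) in \<open>auto simp: is_interval_cc\<close>)
  then show ?thesis
    using that \<epsilon>(1) by blast
qed

text \<open>Zorn's lemma is applied to graphs over the time interval. A graph forgets the irrelevant
  values outside \<open>J\<close>, so inclusion of graphs is exactly extension of solutions, and the
  union of a chain is again such a graph.\<close>

lemma maximal_solution_extends:
  assumes sol0: "is_solution S \<xi> x0 J0 u0"
  obtains J u where "is_maximal_solution S \<xi> x0 J u" "J0 \<subseteq> J" "\<And>t. t \<in> J0 \<Longrightarrow> u t = u0 t"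
proof -
  define graph :: "real set \<Rightarrow> (real \<Rightarrow> real^'a) \<Rightarrow> (real \<times> (real^'a)) set"
    where "graph J u = (\<lambda>t. (t, u t)) ` J" for J u
  define A where "A = {graph J u | J u. is_solution S \<xi> x0 J u \<and> graph J0 u0 \<subseteq> graph J u}"
  have graph_sub: "graph J u \<subseteq> graph J' u' \<longleftrightarrow> J \<subseteq> J' \<and> (\<forall>t\<in>J. u' t = u t)" for J J' u u'
    by (auto simp: graph_def)
  have "A \<noteq> {}"
    using sol0 by (auto simp: A_def)
  have "\<exists>M\<in>A. \<forall>X\<in>A. M \<subseteq> X \<longrightarrow> X = M"
  proof (rule subset_Zorn_nonempty[OF \<open>A \<noteq> {}\<close>])
    fix \<C> assume ne: "\<C> \<noteq> {}" and chain: "subset.chain A \<C>"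
    define JJ where "JJ = {(J, u). is_solution S \<xi> x0 J u \<and> graph J0 u0 \<subseteq> graph J u \<and> graph J u \<in> \<C>}"
    have CJ: "\<C> = (\<lambda>(J, u). graph J u) ` JJ"
      using chain unfolding subset.chain_def A_def JJ_def by auto
    have cmp: "(J1 \<subseteq> J2 \<and> (\<forall>t\<in>J1. u2 t = u1 t)) \<or> (J2 \<subseteq> J1 \<and> (\<forall>t\<in>J2. u1 t = u2 t))"
      if "(J1, u1) \<in> JJ" "(J2, u2) \<in> JJ" for J1 u1 J2 u2
    proof -
      have "graph J1 u1 \<subseteq> graph J2 u2 \<or> graph J2 u2 \<subseteq> graph J1 u1"
        using that subset.chain_total[OF chain] by (fastforce simp: JJ_def)
      then show ?thesis
        by (simp only: graph_sub)
    qed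
    define J where "J = \<Union>(fst ` JJ)"
    define u where "u t = (SOME x. \<exists>(J, v)\<in>JJ. t \<in> J \<and> x = v t)" for t
    have u: "u t = v t" if "(K, v) \<in> JJ" "t \<in> K" for K v t
    proof -
      have "\<exists>(J, w)\<in>JJ. t \<in> J \<and> u t = w t"
        unfolding u_def by (rule someI_ex) (use that in blast)
      then show ?thesis
        using cmp[OF that(1)] that(2) by fastforce
    qed
    have sol: "is_solution S \<xi> x0 K v" if "(K, v) \<in> JJ" for K v
      using that by (simp add: JJ_def)
    obtain K0 v0 where K0: "(K0, v0) \<in> JJ"
      using ne CJ by auto
    have seg: "{0..t} \<subseteq> K" if "(K, v) \<in> JJ" "t \<in> K" for K v t
    proof
      fix s assume "s \<in> {0..t}"
      moreover have "is_interval K" "0 \<in> K"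
        using sol[OF that(1)] by (simp_all add: is_solution_def)
      ultimately show "s \<in> K"
        using mem_is_interval_1_I[of K 0 t s] that(2) by simp
    qed
    have solD: "K \<subseteq> {0..}" "0 \<in> K" "v 0 = x0" "v ` K \<subseteq> S" if "(K, v) \<in> JJ" for K v
      using sol[OF that] by (simp_all add: is_solution_def)
    have KJ: "K \<subseteq> J" if "(K, v) \<in> JJ" for K v
      using that by (force simp: J_def)
    have JE: "\<exists>K v. (K, v) \<in> JJ \<and> t \<in> K" if "t \<in> J" for t
      using that by (auto simp: J_def)
    have Jpos: "J \<subseteq> {0..}"
      using JE solD(1) by blast
    have "is_solution S \<xi> x0 J u"
      unfolding is_solution_def
    proof (intro conjI ballI)
      show "is_interval J"
        unfolding is_interval_1
      proof (intro ballI allI impI)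
        fix a b x assume "a \<in> J" "b \<in> J" "a \<le> x \<and> x \<le> b"
        then have "a \<le> x" "x \<le> b"
          by auto
        obtain K v where K: "(K, v) \<in> JJ" "b \<in> K"
          using JE[OF \<open>b \<in> J\<close>] by blast
        have "0 \<le> a"
          using \<open>a \<in> J\<close> Jpos by auto
        then have "x \<in> K"
          using seg[OF K] \<open>a \<le> x\<close> \<open>x \<le> b\<close> by auto
        then show "x \<in> J"
          using KJ[OF K(1)] by blast
      qed
      show "0 \<in> J"
        using KJ[OF K0] solD(2)[OF K0] by blast
      show "J \<subseteq> {0..}"
        by (rule Jpos)
      show "u 0 = x0"
        using u[OF K0 solD(2)[OF K0]] solD(3)[OF K0] by simp
      show "u ` J \<subseteq> S"
      proof
        fix y assume "y \<in> u ` J"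
        then obtain t K v where "y = u t" "(K, v) \<in> JJ" "t \<in> K"
          using JE by blast
        then show "y \<in> S"
          using u solD(4) by fastforce
      qed
      fix t assume "t \<in> J"
      \<comment> \<open>Some member of the chain coincides with \<open>J\<close> up to a time beyond \<open>t\<close>.\<close>
      have "\<exists>K v b. (K, v) \<in> JJ \<and> t \<in> K \<and> t < b \<and> J \<inter> {..<b} = K \<inter> {..<b}"
      proof (cases "\<exists>b\<in>J. t < b")
        case True
        then obtain b K v where b: "(K, v) \<in> JJ" "b \<in> K" "t < b"
          using JE by blast
        have "J \<inter> {..<b} \<subseteq> K \<inter> {..<b}"
          using seg[OF b(1,2)] Jpos by fastforce
        moreover have "K \<subseteq> J"
          by (rule KJ[OF b(1)])
        ultimately show ?thesis
          using b seg[OF b(1,2)] \<open>t \<in> J\<close> Jpos by (intro exI[of _ K] exI[of _ v] exI[of _ b]) auto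
      next
        \<comment> \<open>Here \<open>t\<close> is the last time of \<open>J\<close>; a member of
          the chain that reaches \<open>t\<close> is all of \<open>J\<close>, and any bound beyond
          \<open>t\<close> will do.\<close>
        case False
        obtain K v where K: "(K, v) \<in> JJ" "t \<in> K"
          using JE[OF \<open>t \<in> J\<close>] by blast
        have "J \<subseteq> K"
          using seg[OF K] Jpos False by fastforce
        moreover have "K \<subseteq> J"
          by (rule KJ[OF K(1)])
        ultimately show ?thesis
          using K by (intro exI[of _ K] exI[of _ v] exI[of _ "t + 1"]) auto
      qed
      then obtain K v b where K: "(K, v) \<in> JJ" "t \<in> K" "t < b" "J \<inter> {..<b} = K \<inter> {..<b}"
        by blast
      have "(v has_vector_derivative \<xi> (v t)) (at t within K)"
        using sol[OF K(1)] K(2) by (simp add: is_solution_def)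
      then have "(u has_vector_derivative \<xi> (v t)) (at t within K)"
        using has_vector_derivative_transform[OF K(2)] u[OF K(1)] by blast
      moreover have "at t within K = at t within J"
        using K(3,4) by (intro at_within_nhd[of t "{..<b}"]) auto
      ultimately show "(u has_vector_derivative \<xi> (u t)) (at t within J)"
        using u[OF K(1,2)] by simp
    qed
    moreover have "\<Union>\<C> = graph J u"
    proof -
      have "graph K v = graph K u" if "(K, v) \<in> JJ" for K v
        using u[OF that] by (auto simp: graph_def)
      then have "\<Union>\<C> = (\<Union>(K, v)\<in>JJ. graph K u)"
        unfolding CJ by auto
      also have "\<dots> = graph J u"
        by (force simp: J_def graph_def)
      finally show ?thesis .
    qed
    moreover have "graph J0 u0 \<subseteq> \<Union>\<C>"
      using K0 unfolding CJ by (auto simp: JJ_def)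
    ultimately show "\<Union>\<C> \<in> A"
      unfolding A_def by auto
  qed
  then obtain J u where J: "is_solution S \<xi> x0 J u" "graph J0 u0 \<subseteq> graph J u"
    and max: "\<And>X. X \<in> A \<Longrightarrow> graph J u \<subseteq> X \<Longrightarrow> X = graph J u"
    by (auto simp: A_def)
  have "J' = J" if "is_solution S \<xi> x0 J' v" "J \<subseteq> J'" "\<forall>t\<in>J. v t = u t" for J' v
  proof -
    have *: "graph J u \<subseteq> graph J' v"
      using that by (simp add: graph_sub)
    then have "graph J' v = graph J u"
      using max that(1) J(2) unfolding A_def by blast
    then show ?thesis
      using graph_sub by blast
  qed
  then have "is_maximal_solution S \<xi> x0 J u"
    using J(1) by (auto simp: is_maximal_solution_def)
  then show ?thesis
    using that J(2) by (simp add: graph_sub)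
qed

text \<open>A short solution from \<open>x\<close> is extended to a maximal one, along which
  \<open>h\<close> is constant by hypothesis. The one-sided derivative of \<open>h\<close> along it
  at time 0 is therefore zero, and the chain rule identifies that derivative.\<close>

lemma conserved_through_imp_derivative_zero:
  assumes "open S" "conserved_through S W h" "\<xi> \<in> W" "Ck_on (Suc 0) S \<xi>" "x \<in> S"
    and "h differentiable (at x)"
  shows "frechet_derivative h (at x) (\<xi> x) = 0"
proof -
  obtain \<epsilon> u where u: "\<epsilon> > 0" "is_solution S \<xi> x {0..\<epsilon>} u"
    using local_solution[OF assms(1,4,5)] by blast
  then obtain J v where v: "is_maximal_solution S \<xi> x J v" "{0..\<epsilon>} \<subseteq> J" "\<And>t. t \<in> {0..\<epsilon>} \<Longrightarrow> v t = u t"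
    using maximal_solution_extends by blast
  have "(\<lambda>t. h (v t)) constant_on J"
    using assms(2,3,5) v(1) by (auto simp: conserved_through_def)
  then obtain c where "\<And>t. t \<in> {0..\<epsilon>} \<Longrightarrow> h (u t) = c"
    using v(2,3) unfolding constant_on_def by (metis subsetD)
  then have "((\<lambda>t. h (u t)) has_vector_derivative 0) (at 0 within {0..\<epsilon>})"
    using u(1) by (intro has_vector_derivative_transform[OF _ _ has_vector_derivative_const[of c]]) auto
  moreover have "((h \<circ> u) has_vector_derivative frechet_derivative h (at x) (\<xi> x)) (at 0 within {0..\<epsilon>})"
  proof -
    have "u 0 = x" "(u has_vector_derivative \<xi> (u 0)) (at 0 within {0..\<epsilon>})"
      using u by (auto simp: is_solution_def)
    then show ?thesis
      using vector_derivative_diff_chain_within[of u "\<xi> x" 0 "{0..\<epsilon>}" h] assms(6)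
      by (simp add: frechet_derivative_works has_derivative_at_withinI)
  qed
  ultimately show ?thesis
    using vector_derivative_unique_within_closed_interval[of 0 \<epsilon> 0] u(1) by (force simp: o_def)
qed

lemma constant_along_solution:
  fixes h :: "real^'n \<Rightarrow> 'b::real_normed_vector"
  assumes "is_solution S \<xi> x0 J u"
    and "\<And>x. x \<in> S \<Longrightarrow> h differentiable (at x)"
    and "\<And>x. x \<in> S \<Longrightarrow> frechet_derivative h (at x) (\<xi> x) = 0"
  shows "(\<lambda>t. h (u t)) constant_on J"
proof -
  have J: "convex J" "u ` J \<subseteq> S" "\<And>t. t \<in> J \<Longrightarrow> (u has_vector_derivative \<xi> (u t)) (at t within J)"
    using assms(1) by (auto simp: is_solution_def is_interval_convex)
  have "(h \<circ> u has_vector_derivative 0) (at t within J)" if "t \<in> J" for t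
    using vector_derivative_diff_chain_within[OF J(3)[OF that]] assms(2,3) J(2) that
    by (metis frechet_derivative_works has_derivative_at_withinI image_subset_iff)
  then have "\<exists>c. \<forall>t\<in>J. (h \<circ> u) t = c"
    by (intro has_derivative_zero_constant[OF J(1)]) (simp add: has_vector_derivative_def o_def)
  then show ?thesis
    by (simp add: constant_on_def)
qed

section \<open>Annihilation of brackets by \<open>C\<^sup>1\<close> functions\<close>

text \<open>A product rule with one factor merely continuous. Since \<open>g z\<close> is of order
  \<open>norm (z - x)\<close>, the product of \<open>f z - f x\<close> with \<open>g z\<close> is of
  smaller order, and \<open>f\<close> enters only through its value at \<open>x\<close>.\<close>

lemma has_derivative_inner_vanishing:
  fixes f g :: "'a::real_normed_vector \<Rightarrow> 'b::real_inner"
  assumes f: "isCont f x" and g: "(g has_derivative g') (at x)" and "g x = 0"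
  shows "((\<lambda>z. f z \<bullet> g z) has_derivative (\<lambda>w. f x \<bullet> g' w)) (at x)"
proof -
  have "((\<lambda>z. (f z - f x) \<bullet> g z) has_derivative (\<lambda>w. 0)) (at x)"
    unfolding has_derivative_iff_norm
  proof (intro conjI)
    have "((\<lambda>z. norm (g z - g x - g' (z - x)) / norm (z - x)) \<longlongrightarrow> 0) (at x)"
      using g by (simp add: has_derivative_iff_norm)
    then have "\<forall>\<^sub>F z in at x. norm (g z - g x - g' (z - x)) / norm (z - x) < 1"
      by (rule order_tendstoD) simp
    moreover obtain C where C: "\<And>w. norm (g' w) \<le> norm w * C"
      using bounded_linear.bounded[OF has_derivative_bounded_linear[OF g]] by blast
    ultimately have "\<forall>\<^sub>F z in at x. norm (g z) \<le> (1 + C) * norm (z - x)"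
    proof (elim eventually_mono)
      fix z assume "norm (g z - g x - g' (z - x)) / norm (z - x) < 1"
      then have "norm (g z - g' (z - x)) \<le> norm (z - x)"
      proof (cases "z = x")
        case True
        then show ?thesis
          using C[of 0] \<open>g x = 0\<close> by simp
      next
        case False
        then have "norm (g z - g x - g' (z - x)) < norm (z - x)"
          using \<open>norm (g z - g x - g' (z - x)) / norm (z - x) < 1\<close> by (simp add: divide_simps)
        then show ?thesis
          using \<open>g x = 0\<close> by simp
      qed
      then show "norm (g z) \<le> (1 + C) * norm (z - x)"
        using C[of "z - x"] norm_triangle_sub[of "g z" "g' (z - x)"] by (simp add: algebra_simps)
    qed
    then have small: "\<forall>\<^sub>F z in at x. norm (norm ((f z - f x) \<bullet> g z - (f x - f x) \<bullet> g x - 0) / norm (z - x))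
        \<le> norm (f z - f x) * (1 + C)"
    proof (elim eventually_mono)
      fix z assume *: "norm (g z) \<le> (1 + C) * norm (z - x)"
      have "\<bar>(f z - f x) \<bullet> g z\<bar> \<le> norm (f z - f x) * ((1 + C) * norm (z - x))"
        using Cauchy_Schwarz_ineq2[of "f z - f x" "g z"] mult_left_mono[OF *, of "norm (f z - f x)"] by simp
      moreover have "g z = 0" if "z = x"
        using that \<open>g x = 0\<close> by simp
      ultimately show "norm (norm ((f z - f x) \<bullet> g z - (f x - f x) \<bullet> g x - 0) / norm (z - x))
          \<le> norm (f z - f x) * (1 + C)"
        by (cases "z = x") (auto simp: divide_simps mult.assoc)
    qed
    have lim: "((\<lambda>z. norm (f z - f x) * (1 + C)) \<longlongrightarrow> norm (f x - f x) * (1 + C)) (at x)"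
      using f by (intro tendsto_intros) (auto simp: isCont_def)
    show "((\<lambda>z. norm ((f z - f x) \<bullet> g z - (f x - f x) \<bullet> g x - 0) / norm (z - x)) \<longlongrightarrow> 0) (at x)"
      by (rule Lim_null_comparison[OF small]) (use lim in simp)
  qed simp
  moreover have "((\<lambda>z. f x \<bullet> g z) has_derivative (\<lambda>w. f x \<bullet> g' w)) (at x)"
    using g by (auto intro!: derivative_eq_intros)
  ultimately have "((\<lambda>z. (f z - f x) \<bullet> g z + f x \<bullet> g z) has_derivative (\<lambda>w. 0 + f x \<bullet> g' w)) (at x)"
    by (rule has_derivative_add)
  then show ?thesis
    by (simp add: inner_diff_left)
qed

text \<open>This uses only differentiability of \<open>z \<mapsto> h' z a\<close> at the one point
  \<open>x\<close>. The mean value theorem along \<open>a\<close> turns the second difference into a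
  difference of two values of \<open>h' z a\<close>, and these are expanded to first order at
  \<open>x\<close>.\<close>

lemma second_difference:
  fixes h :: "'a::real_normed_vector \<Rightarrow> real"
  assumes "open S" "x \<in> S" and h: "\<And>z. z \<in> S \<Longrightarrow> (h has_derivative h' z) (at z)"
    and A: "((\<lambda>z. h' z a) has_derivative A) (at x)" and "e > 0"
  shows "\<exists>d>0. \<forall>s. 0 < s \<and> s < d \<longrightarrow>
    \<bar>h (x + s *\<^sub>R a + s *\<^sub>R b) - h (x + s *\<^sub>R a) - h (x + s *\<^sub>R b) + h x - s\<^sup>2 * A b\<bar> \<le> e * s\<^sup>2"
proof -
  \<comment> \<open>All points met lie within \<open>s * (norm a + norm b)\<close> of
    \<open>x\<close>. Two remainders have to be paid for, hence the factor 2; the summand 1 keeps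
    \<open>M\<close> positive when \<open>a\<close> and \<open>b\<close> vanish.\<close>
  define M where "M = 2 * (norm a + norm b) + 1"
  have M: "M > 0" by (simp add: M_def add_nonneg_pos)
  obtain d1 where d1: "d1 > 0" "\<And>z. norm (z - x) < d1 \<Longrightarrow> \<bar>h' z a - h' x a - A (z - x)\<bar> \<le> e / M * norm (z - x)"
    using A \<open>e > 0\<close> M unfolding has_derivative_at_alt by (metis divide_pos_pos real_norm_def)
  obtain d2 where d2: "d2 > 0" "ball x d2 \<subseteq> S"
    using assms(1,2) openE by blast
  interpret A: linear A
    using A by (rule has_derivative_linear)
  define d where "d = min d1 d2 / M"
  have "\<bar>h (x + s *\<^sub>R a + s *\<^sub>R b) - h (x + s *\<^sub>R a) - h (x + s *\<^sub>R b) + h x - s\<^sup>2 * A b\<bar> \<le> e * s\<^sup>2"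
    if s: "0 < s" "s < d" for s
  proof -
    have sM: "s * M < d1" "s * M < d2"
      using s M by (auto simp: d_def field_simps)
    have nb: "norm (t *\<^sub>R a + c *\<^sub>R b) \<le> s * (norm a + norm b)" if "0 \<le> t" "t \<le> s" "0 \<le> c" "c \<le> s" for t c
    proof -
      have "norm (t *\<^sub>R a + c *\<^sub>R b) \<le> t * norm a + c * norm b"
        using that norm_triangle_ineq[of "t *\<^sub>R a" "c *\<^sub>R b"] by simp
      also have "\<dots> \<le> s * norm a + s * norm b"
        using that by (intro add_mono mult_right_mono) auto
      finally show ?thesis by (simp add: algebra_simps)
    qed
    have sM': "s * (norm a + norm b) < s * M"
      using s(1) by (simp add: M_def add_nonneg_pos)
    have inS: "x + t *\<^sub>R a + c *\<^sub>R b \<in> S" if "0 \<le> t" "t \<le> s" "0 \<le> c" "c \<le> s" for t c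
    proof -
      have "dist x (x + (t *\<^sub>R a + c *\<^sub>R b)) < d2"
        using nb[OF that] sM(2) sM' by (subst dist_commute) (simp add: dist_norm)
      then have "x + (t *\<^sub>R a + c *\<^sub>R b) \<in> S"
        using d2(2) by auto
      then show ?thesis
        by (simp add: add.assoc)
    qed
    \<comment> \<open>The second difference is \<open>\<phi> s - \<phi> 0\<close>. Writing
      \<open>0 *\<^sub>R b\<close> makes both terms instances of \<open>der\<close>, with
      \<open>c = s\<close> and \<open>c = 0\<close>.\<close>
    define \<phi> where "\<phi> t = h (x + t *\<^sub>R a + s *\<^sub>R b) - h (x + t *\<^sub>R a + 0 *\<^sub>R b)" for t
    have der: "((\<lambda>t. h (x + t *\<^sub>R a + c *\<^sub>R b)) has_derivative (\<lambda>k. k * h' (x + t *\<^sub>R a + c *\<^sub>R b) a)) (at t within {0..s})"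
      if "0 \<le> t" "t \<le> s" "0 \<le> c" "c \<le> s" for t c
    proof -
      have "((\<lambda>t. x + t *\<^sub>R a + c *\<^sub>R b) has_derivative (\<lambda>k. k *\<^sub>R a)) (at t within {0..s})"
        by (auto intro!: derivative_eq_intros)
      from has_derivative_compose[OF this h[OF inS[OF that]]]
      show ?thesis
        using linear_scale[OF has_derivative_linear[OF h[OF inS[OF that]]]] by simp
    qed
    have "\<exists>t\<in>{0<..<s}. \<phi> s - \<phi> 0 = (s - 0) * h' (x + t *\<^sub>R a + s *\<^sub>R b) a - (s - 0) * h' (x + t *\<^sub>R a + 0 *\<^sub>R b) a"
      unfolding \<phi>_def using s by (intro mvt_simple has_derivative_diff der) auto
    then obtain t where t: "0 < t" "t < s"
      "\<phi> s - \<phi> 0 = s * h' (x + t *\<^sub>R a + s *\<^sub>R b) a - s * h' (x + t *\<^sub>R a + 0 *\<^sub>R b) a"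
      by auto
    define R where "R w = h' (x + w) a - h' x a - A w" for w
    have R: "\<bar>R w\<bar> \<le> e / M * norm w" if "norm w < d1" for w
      using d1(2)[of "x + w"] that by (simp add: R_def)
    have R1: "\<bar>R (t *\<^sub>R a + c *\<^sub>R b)\<bar> \<le> e / M * (s * (norm a + norm b))" if "0 \<le> c" "c \<le> s" for c
    proof -
      have "norm (t *\<^sub>R a + c *\<^sub>R b) \<le> s * (norm a + norm b)"
        using nb t that by simp
      then show ?thesis
        using R[of "t *\<^sub>R a + c *\<^sub>R b"] sM(1) sM' \<open>e > 0\<close> M
          mult_left_mono[of "norm (t *\<^sub>R a + c *\<^sub>R b)" "s * (norm a + norm b)" "e / M"]
        by (smt (verit) divide_pos_pos)
    qed
    have "\<phi> s - \<phi> 0 - s\<^sup>2 * A b = s * (R (t *\<^sub>R a + s *\<^sub>R b) - R (t *\<^sub>R a + 0 *\<^sub>R b))"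
      unfolding t(3) R_def by (simp add: A.add A.scale algebra_simps power2_eq_square)
    also have "\<bar>\<dots>\<bar> \<le> s * (e / M * (s * (norm a + norm b)) + e / M * (s * (norm a + norm b)))"
      using R1[of s] R1[of 0] s(1) unfolding abs_mult by (intro mult_mono) auto
    also have "\<dots> \<le> e * s\<^sup>2"
    proof -
      have "s * (e / M * (s * (norm a + norm b)) + e / M * (s * (norm a + norm b))) = e * s\<^sup>2 * ((M - 1) / M)"
        by (simp add: M_def power2_eq_square field_simps)
      also have "\<dots> \<le> e * s\<^sup>2 * 1"
        using M \<open>e > 0\<close> by (intro mult_left_mono) auto
      finally show ?thesis by simp
    qed
    finally show ?thesis
      by (simp add: \<phi>_def algebra_simps)
  qed
  moreover have "d > 0"
    using d1 d2 M by (simp add: d_def)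
  ultimately show ?thesis by blast
qed

text \<open>The second difference is symmetric in \<open>a\<close> and \<open>b\<close>, so
  \<open>A b\<close> and \<open>B a\<close> both approximate it after division by the square of
  \<open>s\<close>, with error \<open>e\<close> each. Choosing \<open>e\<close> as a third of the
  supposed gap is contradictory.\<close>

lemma symmetric_directional_derivatives:
  fixes h :: "'a::real_normed_vector \<Rightarrow> real"
  assumes "open S" "x \<in> S" and h: "\<And>z. z \<in> S \<Longrightarrow> (h has_derivative h' z) (at z)"
    and A: "((\<lambda>z. h' z a) has_derivative A) (at x)"
    and B: "((\<lambda>z. h' z b) has_derivative B) (at x)"
  shows "A b = B a"
proof (rule ccontr)
  assume "A b \<noteq> B a"
  define e where "e = \<bar>A b - B a\<bar> / 3"
  have "e > 0"
    using \<open>A b \<noteq> B a\<close> by (simp add: e_def)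
  define \<Delta> where "\<Delta> s = h (x + s *\<^sub>R a + s *\<^sub>R b) - h (x + s *\<^sub>R a) - h (x + s *\<^sub>R b) + h x" for s
  obtain d1 where d1: "d1 > 0" "\<And>s. 0 < s \<Longrightarrow> s < d1 \<Longrightarrow> \<bar>\<Delta> s - s\<^sup>2 * A b\<bar> \<le> e * s\<^sup>2"
    using second_difference[OF assms(1-4) \<open>e > 0\<close>, of b] unfolding \<Delta>_def by blast
  have eq: "h (x + s *\<^sub>R b + s *\<^sub>R a) - h (x + s *\<^sub>R b) - h (x + s *\<^sub>R a) + h x = \<Delta> s" for s
    by (simp add: \<Delta>_def add.commute add.left_commute)
  obtain d2 where d2: "d2 > 0" "\<And>s. 0 < s \<Longrightarrow> s < d2 \<Longrightarrow> \<bar>\<Delta> s - s\<^sup>2 * B a\<bar> \<le> e * s\<^sup>2"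
    using second_difference[OF assms(1-3) B \<open>e > 0\<close>, of a] unfolding eq by blast
  define s where "s = min d1 d2 / 2"
  have s: "0 < s" "s < d1" "s < d2"
    using d1(1) d2(1) by (auto simp: s_def)
  have "s\<^sup>2 * \<bar>A b - B a\<bar> = \<bar>s\<^sup>2 * A b - s\<^sup>2 * B a\<bar>"
    by (simp add: abs_mult flip: right_diff_distrib)
  also have "\<dots> \<le> 2 * e * s\<^sup>2"
    using d1(2)[OF s(1,2)] d2(2)[OF s(1,3)] by linarith
  finally have "\<bar>A b - B a\<bar> \<le> 2 * e"
    using s(1) by (simp add: mult.commute)
  then show False
    using \<open>e > 0\<close> by (simp add: e_def)
qed

text \<open>
  The function \<open>h\<close> is only \<open>C\<^sup>1\<close>. For fixed \<open>a = X x\<close>, however, \<open>dh(z) a = dh(z) (a - X z)\<close> is the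
  pairing of a continuous function with a differentiable one that vanishes at \<open>x\<close>, hence it is
  differentiable at \<open>x\<close>; so the mixed second derivatives of \<open>h\<close> along \<open>X x\<close> and \<open>Y x\<close> exist there
  and agree.
\<close>

lemma annihilates_bracket:
  fixes h :: "real^'n \<Rightarrow> real"
  assumes "open S" "x \<in> S" and h: "Ck_on (Suc 0) S h"
    and X: "(X has_derivative X') (at x)" "\<And>z. z \<in> S \<Longrightarrow> frechet_derivative h (at z) (X z) = 0"
    and Y: "(Y has_derivative Y') (at x)" "\<And>z. z \<in> S \<Longrightarrow> frechet_derivative h (at z) (Y z) = 0"
  shows "frechet_derivative h (at x) (X' (Y x)) = frechet_derivative h (at x) (Y' (X x))"
proof -
  have dh: "grad h z \<bullet> v = frechet_derivative h (at z) v" if "z \<in> S" for z v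
    using h that by (intro grad_inner) simp
  have "continuous_on S (grad h)"
    unfolding grad_def[abs_def] using h by (intro continuous_on_vec_lambda) simp
  then have cont: "isCont (grad h) x"
    using assms(1,2) by (simp add: continuous_on_eq_continuous_at)
  have *: "((\<lambda>z. frechet_derivative h (at z) (Z x)) has_derivative (\<lambda>w. - (grad h x \<bullet> Z' w))) (at x)"
    if Z: "(Z has_derivative Z') (at x)" "\<And>z. z \<in> S \<Longrightarrow> frechet_derivative h (at z) (Z z) = 0" for Z Z'
  proof (rule has_derivative_transform_within_open[OF _ \<open>open S\<close> \<open>x \<in> S\<close>])
    have "((\<lambda>z. Z x - Z z) has_derivative (\<lambda>w. - Z' w)) (at x)"
      using Z(1) by (auto intro!: derivative_eq_intros)
    from has_derivative_inner_vanishing[OF cont this]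
    show "((\<lambda>z. grad h z \<bullet> (Z x - Z z)) has_derivative (\<lambda>w. - (grad h x \<bullet> Z' w))) (at x)"
      by simp
    show "grad h z \<bullet> (Z x - Z z) = frechet_derivative h (at z) (Z x)" if "z \<in> S" for z
      using Z(2)[OF that] by (simp add: inner_diff_right dh that)
  qed
  show ?thesis
    using symmetric_directional_derivatives[OF assms(1,2) Ck_on_has_derivative[OF h] *[OF X] *[OF Y]]
    by (simp add: dh \<open>x \<in> S\<close>)
qed

section \<open>From brackets to the generated Lie algebra; the upper bound\<close>

lemma smooth_fields_has_derivative:
  assumes "\<xi> \<in> smooth_fields \<Omega>" "x \<in> \<Omega>"
  shows "(\<xi> has_derivative frechet_derivative \<xi> (at x)) (at x)"
  using assms by (intro Ck_on_has_derivative[of 0 \<Omega>] smooth_on_Ck) (simp_all add: smooth_fields_def)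

lemma lie_bracket_apply:
  assumes "\<xi>1 \<in> smooth_fields \<Omega>" "\<xi>2 \<in> smooth_fields \<Omega>" "x \<in> \<Omega>"
  shows "lie_bracket \<Omega> \<xi>1 \<xi>2 x =
    frechet_derivative \<xi>1 (at x) (\<xi>2 x) - frechet_derivative \<xi>2 (at x) (\<xi>1 x)"
  using smooth_fields_has_derivative[OF assms(1,3)] smooth_fields_has_derivative[OF assms(2,3)] assms(3)
  by (simp add: lie_bracket_def jacobian_mult differentiableI)

lemma annihilates_Lie:
  fixes h :: "real^'n \<Rightarrow> real"
  assumes "open \<Omega>" "W \<subseteq> smooth_fields \<Omega>" "open S" "S \<subseteq> \<Omega>" and h: "Ck_on (Suc 0) S h"
    and W: "\<And>\<xi> x. \<xi> \<in> W \<Longrightarrow> x \<in> S \<Longrightarrow> frechet_derivative h (at x) (\<xi> x) = 0"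
    and "\<xi> \<in> Lie \<Omega> W" "x \<in> S"
  shows "frechet_derivative h (at x) (\<xi> x) = 0"
proof -
  \<comment> \<open>Annihilation is imposed on the whole open set \<open>S\<close> rather than at
    one point, because the bracket at \<open>x\<close> depends on the fields near
    \<open>x\<close>.\<close>
  define L where "L = {\<xi> \<in> smooth_fields \<Omega>. \<forall>x\<in>S. frechet_derivative h (at x) (\<xi> x) = 0}"
  have lin: "linear (frechet_derivative h (at x))" if "x \<in> S" for x
    using has_derivative_linear[OF Ck_on_has_derivative[OF h that]] .
  have br: "frechet_derivative h (at x) (lie_bracket \<Omega> \<xi>1 \<xi>2 x) = 0"
    if "\<xi>1 \<in> L" "\<xi>2 \<in> L" "x \<in> S" for \<xi>1 \<xi>2 x
  proof -
    have sm: "\<xi>1 \<in> smooth_fields \<Omega>" "\<xi>2 \<in> smooth_fields \<Omega>" and "x \<in> \<Omega>"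
      using that \<open>S \<subseteq> \<Omega>\<close> by (auto simp: L_def)
    have "frechet_derivative h (at x) (frechet_derivative \<xi>1 (at x) (\<xi>2 x)) =
        frechet_derivative h (at x) (frechet_derivative \<xi>2 (at x) (\<xi>1 x))"
      by (rule annihilates_bracket[OF \<open>open S\<close> \<open>x \<in> S\<close> h])
        (use that smooth_fields_has_derivative[OF _ \<open>x \<in> \<Omega>\<close>] sm in \<open>auto simp: L_def\<close>)
    then show ?thesis
      using sm \<open>x \<in> \<Omega>\<close> linear_diff[OF lin[OF \<open>x \<in> S\<close>]] by (simp add: lie_bracket_apply)
  qed
  have sub: "lie_subalgebra \<Omega> (smooth_fields \<Omega>)"
    by (rule lie_subalgebra_smooth_fields[OF assms(1)])
  have "lie_subalgebra \<Omega> L"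
    unfolding lie_subalgebra_def
  proof (intro conjI ballI allI)
    show "(\<lambda>\<theta>\<in>\<Omega>. 0) \<in> L"
      using sub lin \<open>S \<subseteq> \<Omega>\<close> by (auto simp: L_def lie_subalgebra_def subset_iff linear_0)
    show "(\<lambda>\<theta>\<in>\<Omega>. \<xi>1 \<theta> + \<xi>2 \<theta>) \<in> L" if "\<xi>1 \<in> L" "\<xi>2 \<in> L" for \<xi>1 \<xi>2
      using that sub lin \<open>S \<subseteq> \<Omega>\<close> by (auto simp: L_def lie_subalgebra_def subset_iff linear_add)
    show "(\<lambda>\<theta>\<in>\<Omega>. c *\<^sub>R \<xi> \<theta>) \<in> L" if "\<xi> \<in> L" for c \<xi>
      using that sub lin \<open>S \<subseteq> \<Omega>\<close> by (auto simp: L_def lie_subalgebra_def subset_iff linear_scale)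
    show "lie_bracket \<Omega> \<xi>1 \<xi>2 \<in> L" if "\<xi>1 \<in> L" "\<xi>2 \<in> L" for \<xi>1 \<xi>2
      using br[OF that] that sub by (auto simp: L_def lie_subalgebra_def)
  qed (auto simp: L_def)
  moreover have "W \<subseteq> L"
    using assms(2) W by (auto simp: L_def)
  ultimately have "Lie \<Omega> W \<subseteq> L"
    unfolding Lie_def by (intro hull_minimal)
  then show ?thesis
    using assms(7,8) by (auto simp: L_def)
qed

text \<open>Conservation concerns the restricted fields. As \<Omega>' is open, restriction changes
  neither their values nor their derivatives at its points, so they remain regular enough to have
  local solutions.\<close>

lemma conservation_law_annihilates_W:
  assumes "open \<Omega>" "smooth_on \<Omega> \<phi>" "open \<Omega>'" "\<Omega>' \<subseteq> \<Omega>"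
    and "conservation_law \<Omega> \<phi> \<Omega>' h" "Ck_on (Suc 0) \<Omega>' h" "\<xi> \<in> W_space \<Omega> \<phi>" "x \<in> \<Omega>'"
  shows "frechet_derivative h (at x) (\<xi> x) = 0"
proof -
  have "Ck_on (Suc 0) \<Omega>' \<xi>"
    using W_space_subset_smooth_fields[OF assms(1,2)] assms(7)
    by (intro Ck_on_subset[OF _ assms(4)] smooth_on_Ck) (auto simp: smooth_fields_def)
  then have "Ck_on (Suc 0) \<Omega>' (restrict \<xi> \<Omega>')"
    by (simp only: Ck_on_restrict[OF assms(3)])
  from this assms(6,8) have "frechet_derivative h (at x) (restrict \<xi> \<Omega>' x) = 0"
    by (intro conserved_through_imp_derivative_zero[OF assms(3)
          assms(5)[unfolded conservation_law_def] imageI[OF assms(7)]]) (assumption, simp_all)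
  then show ?thesis
    using assms(8) by simp
qed

lemma independent_conservation_laws_le:
  fixes \<phi> :: "real^'n \<Rightarrow> real^'d"
  assumes "open \<Omega>" "smooth_on \<Omega> \<phi>" "open \<Omega>'" "\<Omega>' \<subseteq> \<Omega>" "\<theta> \<in> \<Omega>'"
    and "independent_conservation_laws \<Omega> \<phi> \<Omega>' N h"
  shows "N \<le> CARD('n) - dim (trace_at (Lie \<Omega> (W_space \<Omega> \<phi>)) \<theta>)"
proof -
  define T where "T = trace_at (Lie \<Omega> (W_space \<Omega> \<phi>)) \<theta>"
  define G where "G = (\<lambda>i. grad (h i) \<theta>) ` {..<N}"
  have h: "Ck_on (Suc 0) \<Omega>' (h i)" "conservation_law \<Omega> \<phi> \<Omega>' (h i)" if "i < N" for i
    using assms(6) that by (simp_all add: independent_conservation_laws_def)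
  have "orthogonal v (grad (h i) \<theta>)" if "i < N" "v \<in> T" for i v
  proof -
    have gr: "grad (h i) \<theta> \<bullet> \<xi> \<theta> = 0" if "\<xi> \<in> Lie \<Omega> (W_space \<Omega> \<phi>)" for \<xi>
    proof -
      have "frechet_derivative (h i) (at \<theta>) (\<xi> \<theta>) = 0"
        by (rule annihilates_Lie[OF assms(1) W_space_subset_smooth_fields[OF assms(1,2)] assms(3,4)
              h(1)[OF \<open>i < N\<close>] _ that assms(5)])
          (rule conservation_law_annihilates_W[OF assms(1-4) h(2,1)[OF \<open>i < N\<close>]])
      then show ?thesis
        using h(1)[OF \<open>i < N\<close>] assms(5) by (subst grad_inner) auto
    qed
    have "v \<in> span ((\<lambda>\<xi>. \<xi> \<theta>) ` Lie \<Omega> (W_space \<Omega> \<phi>))"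
      using that by (simp add: T_def trace_at_def)
    moreover have "subspace {v. grad (h i) \<theta> \<bullet> v = 0}"
      by (auto simp: subspace_def inner_add_right)
    moreover have "grad (h i) \<theta> \<bullet> w = 0" if "w \<in> (\<lambda>\<xi>. \<xi> \<theta>) ` Lie \<Omega> (W_space \<Omega> \<phi>)" for w
      using that gr by blast
    ultimately have "grad (h i) \<theta> \<bullet> v = 0"
      by (rule span_induct)
    then show ?thesis
      by (simp add: orthogonal_def inner_commute)
  qed
  then have "G \<subseteq> {y \<in> UNIV. \<forall>x\<in>T. orthogonal x y}"
    by (auto simp: G_def)
  moreover have "independent G" "card G = N"
    using assms(5,6) by (auto simp: independent_conservation_laws_def G_def card_image)
  ultimately have "N \<le> dim {y \<in> UNIV. \<forall>x\<in>T. orthogonal x y}"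
    using independent_card_le_dim by blast
  moreover have "dim {y \<in> UNIV. \<forall>x\<in>T. orthogonal x y} + dim T = dim (UNIV :: (real^'n) set)"
    by (rule dim_subspace_orthogonal_to_vectors) (auto simp: T_def trace_at_def)
  ultimately show ?thesis
    by (simp add: T_def)
qed

section \<open>First integrals of commuting frames\<close>

text \<open>\<open>B' y w a\<close> is the derivative of the field \<open>B(\<cdot>) a\<close> at
  \<open>y\<close> in direction \<open>w\<close>, and \<open>commute\<close> says that any two such
  fields have zero bracket. One constant \<open>K\<close> serves all estimates. The bound on
  \<open>8 * K * \<epsilon>\<close> makes the combined system of orbit and variation Lipschitz with
  constant 1/2. Its speed is at most \<open>3 * K * \<epsilon>\<close>, so the last two bounds keep
  the orbit within \<open>R / 2\<close> of \<open>\<theta>0\<close> and the variation in the unit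
  ball. The other half of \<open>R\<close> leaves room for perturbed curves.\<close>

locale commuting_frame =
  fixes B :: "real^'n \<Rightarrow> real^'n \<Rightarrow> real^'n" and B' :: "real^'n \<Rightarrow> real^'n \<Rightarrow> real^'n \<Rightarrow> real^'n"
    and \<theta>0 :: "real^'n" and R K \<epsilon> :: real
  assumes deriv: "y \<in> cball \<theta>0 R \<Longrightarrow> ((\<lambda>y. B y a) has_derivative (\<lambda>w. B' y w a)) (at y)"
    and lin: "y \<in> cball \<theta>0 R \<Longrightarrow> linear (B y)"
    and lin': "y \<in> cball \<theta>0 R \<Longrightarrow> linear (B' y w)"
    and bound: "y \<in> cball \<theta>0 R \<Longrightarrow> norm (B y a) \<le> K * norm a"
    and bound': "y \<in> cball \<theta>0 R \<Longrightarrow> norm (B' y w a) \<le> K * norm w * norm a"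
    and lipschitz: "y \<in> cball \<theta>0 R \<Longrightarrow> z \<in> cball \<theta>0 R \<Longrightarrow> norm (B y a - B z a) \<le> K * norm (y - z) * norm a"
    and lipschitz': "y \<in> cball \<theta>0 R \<Longrightarrow> z \<in> cball \<theta>0 R \<Longrightarrow>
      norm (B' y w a - B' z w a) \<le> K * norm (y - z) * norm w * norm a"
    and taylor: "y \<in> cball \<theta>0 R \<Longrightarrow> z \<in> cball \<theta>0 R \<Longrightarrow>
      norm (B z a - B y a - B' y (z - y) a) \<le> K * (norm (z - y))\<^sup>2 * norm a"
    and commute: "y \<in> cball \<theta>0 R \<Longrightarrow> B' y (B y b) a = B' y (B y a) b"
    and K: "K > 0" and \<epsilon>: "\<epsilon> > 0" "8 * K * \<epsilon> \<le> 1" "\<epsilon> + 3 * K * \<epsilon> \<le> R / 2" "\<epsilon> + 3 * K * \<epsilon> \<le> 1"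
begin

lemma B'_linear: "y \<in> cball \<theta>0 R \<Longrightarrow> linear (\<lambda>w. B' y w a)"
  using deriv by (rule has_derivative_linear)

lemma radius: "R > 0" "cball \<theta>0 (R / 2) \<subseteq> cball \<theta>0 R" "cball \<theta>0 \<epsilon> \<subseteq> cball \<theta>0 (R / 2)"
proof -
  have "3 * K * \<epsilon> > 0" "\<epsilon> > 0"
    using K \<epsilon>(1) by simp_all
  then show "R > 0"
    using \<epsilon>(3) by linarith
  then show "cball \<theta>0 (R / 2) \<subseteq> cball \<theta>0 R" "cball \<theta>0 \<epsilon> \<subseteq> cball \<theta>0 (R / 2)"
    using \<epsilon>(3) \<open>3 * K * \<epsilon> > 0\<close> by (auto intro!: subset_cball)
qed

definition flow :: "real^'n \<Rightarrow> (real \<Rightarrow> real^'n) \<Rightarrow> bool" where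
  "flow y \<gamma> \<longleftrightarrow> \<gamma> 0 = y \<and> (\<forall>t\<in>{0..1}. \<gamma> t \<in> cball \<theta>0 (R / 2) \<and>
     (\<gamma> has_vector_derivative - B (\<gamma> t) (y - \<theta>0)) (at t within {0..1}))"

text \<open>The variational equation along \<open>\<gamma>\<close> in direction \<open>k\<close>, scaled by \<open>\<epsilon>\<close> to keep the solutions bounded.\<close>

definition variation :: "real^'n \<Rightarrow> real^'n \<Rightarrow> (real \<Rightarrow> real^'n) \<Rightarrow> (real \<Rightarrow> real^'n) \<Rightarrow> bool" where
  "variation y k \<gamma> z \<longleftrightarrow> z 0 = \<epsilon> *\<^sub>R k \<and> (\<forall>t\<in>{0..1}. norm (z t) \<le> 1 \<and>
     (z has_vector_derivative - B' (\<gamma> t) (z t) (y - \<theta>0) - \<epsilon> *\<^sub>R B (\<gamma> t) k) (at t within {0..1}))"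

text \<open>Since \<open>norm (y - \<theta>0) \<le> \<epsilon>\<close>, the field
  \<open>B(\<cdot>) (y - \<theta>0)\<close> has Lipschitz constant at most 1/2, and
  \<open>short_time_gronwall\<close> applies to the difference of the orbit and an approximate
  solution \<open>v\<close> with defect \<open>\<eta>\<close>. Uniqueness, Lipschitz dependence on
  \<open>y\<close> and differentiability all come from suitable choices of \<open>v\<close>.\<close>

lemma flow_stability:
  assumes y: "y \<in> cball \<theta>0 \<epsilon>" and "flow y \<gamma>"
    and v: "\<And>t. t \<in> {0..1} \<Longrightarrow> v t \<in> cball \<theta>0 R"
      "\<And>t. t \<in> {0..1} \<Longrightarrow> (v has_vector_derivative v' t) (at t within {0..1})"
      "\<And>t. t \<in> {0..1} \<Longrightarrow> norm (v' t + B (v t) (y - \<theta>0)) \<le> \<eta>"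
    and "t \<in> {0..1}"
  shows "norm (v t - \<gamma> t) \<le> 2 * (norm (v 0 - y) + \<eta>)"
proof -
  have \<gamma>: "\<gamma> 0 = y" "\<And>t. t \<in> {0..1} \<Longrightarrow> \<gamma> t \<in> cball \<theta>0 R"
    "\<And>t. t \<in> {0..1} \<Longrightarrow> (\<gamma> has_vector_derivative - B (\<gamma> t) (y - \<theta>0)) (at t within {0..1})"
    using \<open>flow y \<gamma>\<close> radius(2) by (auto simp: flow_def simp del: mem_cball)
  have "norm (v t - \<gamma> t) \<le> 2 * (norm (v 0 - \<gamma> 0) + \<eta>)"
  proof (rule short_time_gronwall[where d'="\<lambda>t. v' t - (- B (\<gamma> t) (y - \<theta>0))"])
    fix t :: real assume t: "t \<in> {0..1}"
    show "((\<lambda>t. v t - \<gamma> t) has_vector_derivative v' t - (- B (\<gamma> t) (y - \<theta>0))) (at t within {0..1})"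
      by (intro has_vector_derivative_diff v \<gamma> t)
    have "norm (B (\<gamma> t) (y - \<theta>0) - B (v t) (y - \<theta>0)) \<le> K * norm (\<gamma> t - v t) * norm (y - \<theta>0)"
      by (intro lipschitz v \<gamma> t)
    also have "\<dots> \<le> K * norm (\<gamma> t - v t) * \<epsilon>"
      using y K by (intro mult_left_mono) (auto simp: dist_norm norm_minus_commute)
    also have "\<dots> = (K * \<epsilon>) * norm (v t - \<gamma> t)"
      by (simp add: norm_minus_commute)
    also have "\<dots> \<le> 1 / 2 * norm (v t - \<gamma> t)"
      using \<epsilon>(2) by (intro mult_right_mono) auto
    finally have "norm (B (\<gamma> t) (y - \<theta>0) - B (v t) (y - \<theta>0)) \<le> norm (v t - \<gamma> t) / 2"
      by simp
    then have "norm ((B (\<gamma> t) (y - \<theta>0) - B (v t) (y - \<theta>0)) + (v' t + B (v t) (y - \<theta>0))) \<le> norm (v t - \<gamma> t) / 2 + \<eta>"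
      using v(3)[OF t] by (intro norm_triangle_le) linarith
    then show "norm (v' t - (- B (\<gamma> t) (y - \<theta>0))) \<le> norm (v t - \<gamma> t) / 2 + \<eta>"
      by (simp add: add.commute)
  qed fact
  then show ?thesis
    by (simp add: \<gamma>(1))
qed

lemma flow_unique:
  assumes "y \<in> cball \<theta>0 \<epsilon>" "flow y \<gamma>1" "flow y \<gamma>2" "t \<in> {0..1}"
  shows "\<gamma>1 t = \<gamma>2 t"
proof -
  have "norm (\<gamma>1 t - \<gamma>2 t) \<le> 2 * (norm (\<gamma>1 0 - y) + 0)"
    by (rule flow_stability[OF assms(1,3) _ _ _ assms(4), where v'="\<lambda>t. - B (\<gamma>1 t) (y - \<theta>0)"])
      (use assms(2) radius(2) in \<open>auto simp: flow_def simp del: mem_cball\<close>)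
  then show ?thesis
    using assms(2) by (simp add: flow_def)
qed

text \<open>The variational equation depends on time through \<gamma>. Solving for the pair of orbit
  and variation makes the system autonomous, so that \<open>picard\<close> covers both at
  once.\<close>

lemma flow_variation_exists:
  assumes y: "y \<in> cball \<theta>0 \<epsilon>" and k: "norm k \<le> 1"
  shows "\<exists>\<gamma> z. flow y \<gamma> \<and> variation y k \<gamma> z"
proof -
  define F where "F = (\<lambda>(g, z). (- B g (y - \<theta>0), - B' g z (y - \<theta>0) - \<epsilon> *\<^sub>R B g k))"
  define S :: "((real^'n) \<times> (real^'n)) set" where "S = cball \<theta>0 (R / 2) \<times> cball 0 1"
  have p: "norm (y - \<theta>0) \<le> \<epsilon>"
    using y by (simp add: dist_norm norm_minus_commute)
  have lip: "norm (F a - F b) \<le> norm (a - b) / 2" if "a \<in> S" "b \<in> S" for a b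
  proof -
    obtain g1 z1 g2 z2 where ab: "a = (g1, z1)" "b = (g2, z2)"
      by (metis surj_pair)
    have mem: "g1 \<in> cball \<theta>0 R" "g2 \<in> cball \<theta>0 R" and nz: "norm z1 \<le> 1"
      using that radius(2) by (auto simp: S_def ab simp del: mem_cball)
    have ng: "norm (g1 - g2) \<le> norm (a - b)" and nz': "norm (z1 - z2) \<le> norm (a - b)"
      using norm_fst_le[of "g1 - g2" "z1 - z2"] norm_snd_le[of "z1 - z2" "g1 - g2"] by (simp_all add: ab)
    have 1: "norm (B g1 (y - \<theta>0) - B g2 (y - \<theta>0)) \<le> K * \<epsilon> * norm (a - b)"
    proof -
      have "norm (B g1 (y - \<theta>0) - B g2 (y - \<theta>0)) \<le> K * norm (g1 - g2) * norm (y - \<theta>0)"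
        by (rule lipschitz[OF mem])
      also have "\<dots> \<le> K * norm (a - b) * \<epsilon>"
        using p K \<epsilon>(1) ng by (intro mult_mono) auto
      finally show ?thesis by (simp add: algebra_simps)
    qed
    have 2: "norm (B' g1 z1 (y - \<theta>0) - B' g2 z1 (y - \<theta>0)) \<le> K * \<epsilon> * norm (a - b)"
    proof -
      have "norm (B' g1 z1 (y - \<theta>0) - B' g2 z1 (y - \<theta>0)) \<le> K * norm (g1 - g2) * norm z1 * norm (y - \<theta>0)"
        by (rule lipschitz'[OF mem])
      also have "\<dots> \<le> K * norm (a - b) * 1 * \<epsilon>"
        using p K \<epsilon>(1) ng nz by (intro mult_mono) auto
      finally show ?thesis by (simp add: algebra_simps)
    qed
    have 3: "norm (B' g2 z1 (y - \<theta>0) - B' g2 z2 (y - \<theta>0)) \<le> K * \<epsilon> * norm (a - b)"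
    proof -
      have "norm (B' g2 z1 (y - \<theta>0) - B' g2 z2 (y - \<theta>0)) = norm (B' g2 (z1 - z2) (y - \<theta>0))"
        by (simp add: linear_diff[OF B'_linear[OF mem(2)]])
      also have "\<dots> \<le> K * norm (z1 - z2) * norm (y - \<theta>0)"
        by (rule bound'[OF mem(2)])
      also have "\<dots> \<le> K * norm (a - b) * \<epsilon>"
        using p K \<epsilon>(1) nz' by (intro mult_mono) auto
      finally show ?thesis by (simp add: algebra_simps)
    qed
    have 4: "norm (\<epsilon> *\<^sub>R (B g1 k - B g2 k)) \<le> K * \<epsilon> * norm (a - b)"
    proof -
      have "norm (\<epsilon> *\<^sub>R (B g1 k - B g2 k)) \<le> \<epsilon> * (K * norm (g1 - g2) * norm k)"
        using lipschitz[OF mem, of k] \<epsilon>(1) by simp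
      also have "\<dots> \<le> \<epsilon> * (K * norm (a - b) * 1)"
        using k K \<epsilon>(1) ng by (intro mult_mono) auto
      finally show ?thesis by (simp add: algebra_simps)
    qed
    have "norm (F a - F b) \<le> norm (- B g1 (y - \<theta>0) - - B g2 (y - \<theta>0)) +
        norm (- B' g1 z1 (y - \<theta>0) - \<epsilon> *\<^sub>R B g1 k - (- B' g2 z2 (y - \<theta>0) - \<epsilon> *\<^sub>R B g2 k))"
      by (simp only: F_def ab prod.case diff_Pair norm_Pair_le)
    also have "- B g1 (y - \<theta>0) - - B g2 (y - \<theta>0) = - (B g1 (y - \<theta>0) - B g2 (y - \<theta>0))"
      by simp
    also have "- B' g1 z1 (y - \<theta>0) - \<epsilon> *\<^sub>R B g1 k - (- B' g2 z2 (y - \<theta>0) - \<epsilon> *\<^sub>R B g2 k) =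
        - ((B' g1 z1 (y - \<theta>0) - B' g2 z1 (y - \<theta>0)) + (B' g2 z1 (y - \<theta>0) - B' g2 z2 (y - \<theta>0))
          + \<epsilon> *\<^sub>R (B g1 k - B g2 k))"
      by (simp add: scaleR_diff_right)
    \<comment> \<open>Four differences, each at most \<open>K * \<epsilon> * norm (a - b)\<close>:
      this is where the 8 in \<open>8 * K * \<epsilon> \<le> 1\<close> comes from.\<close>
    also have "norm (- (B g1 (y - \<theta>0) - B g2 (y - \<theta>0))) + norm \<dots> \<le> 4 * (K * \<epsilon> * norm (a - b))"
      unfolding norm_minus_cancel
      using 1 norm_triangle_le[OF add_mono[OF norm_triangle_le[OF add_mono[OF 2 3]] 4]] by linarith
    also have "\<dots> = 4 * K * \<epsilon> * norm (a - b)" by simp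
    also have "\<dots> \<le> 1 / 2 * norm (a - b)"
      using \<epsilon>(2) by (intro mult_right_mono) auto
    finally show ?thesis by simp
  qed
  have bnd: "norm (F a) \<le> 3 * K * \<epsilon>" if "a \<in> S" for a
  proof -
    obtain g z where a: "a = (g, z)"
      by (metis surj_pair)
    have mem: "g \<in> cball \<theta>0 R" and nz: "norm z \<le> 1"
      using that radius(2) by (auto simp: S_def a simp del: mem_cball)
    have 1: "norm (B g (y - \<theta>0)) \<le> K * \<epsilon>"
      using order_trans[OF bound[OF mem, of "y - \<theta>0"] mult_left_mono[OF p, of K]] K by simp
    have "norm (B' g z (y - \<theta>0)) \<le> K * norm z * norm (y - \<theta>0)"
      by (rule bound'[OF mem])
    also have "\<dots> \<le> K * 1 * \<epsilon>"
      using p K \<epsilon>(1) nz by (intro mult_mono) auto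
    finally have 2: "norm (- B' g z (y - \<theta>0)) \<le> K * \<epsilon>" by simp
    have "norm (\<epsilon> *\<^sub>R B g k) \<le> \<epsilon> * (K * norm k)"
      using bound[OF mem, of k] \<epsilon>(1) by simp
    also have "\<dots> \<le> \<epsilon> * (K * 1)"
      using k K \<epsilon>(1) by (intro mult_left_mono) auto
    finally have 3: "norm (\<epsilon> *\<^sub>R B g k) \<le> K * \<epsilon>" by (simp add: mult.commute)
    have "norm (F a) \<le> norm (- B g (y - \<theta>0)) + norm (- B' g z (y - \<theta>0) - \<epsilon> *\<^sub>R B g k)"
      by (simp only: F_def a prod.case norm_Pair_le)
    also have "\<dots> \<le> norm (- B g (y - \<theta>0)) + (norm (- B' g z (y - \<theta>0)) + norm (\<epsilon> *\<^sub>R B g k))"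
      by (intro add_left_mono norm_triangle_ineq4)
    also have "\<dots> \<le> K * \<epsilon> + (K * \<epsilon> + K * \<epsilon>)"
      using 1 2 3 by (intro add_mono) auto
    finally show ?thesis by simp
  qed
  have ball: "cball (y, \<epsilon> *\<^sub>R k) (3 * K * \<epsilon>) \<subseteq> S"
  proof
    fix a assume a: "a \<in> cball (y, \<epsilon> *\<^sub>R k) (3 * K * \<epsilon>)"
    have "dist y (fst a) \<le> 3 * K * \<epsilon>" "dist (\<epsilon> *\<^sub>R k) (snd a) \<le> 3 * K * \<epsilon>"
      using a dist_fst_le[of "(y, \<epsilon> *\<^sub>R k)" a] dist_snd_le[of "(y, \<epsilon> *\<^sub>R k)" a] by auto
    moreover have "dist \<theta>0 y \<le> \<epsilon>" "dist 0 (\<epsilon> *\<^sub>R k) \<le> \<epsilon>"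
      using y k \<epsilon>(1) by auto
    ultimately have "dist \<theta>0 (fst a) \<le> R / 2" "dist 0 (snd a) \<le> 1"
      using dist_triangle[of \<theta>0 "fst a" y] dist_triangle[of 0 "snd a" "\<epsilon> *\<^sub>R k"] \<epsilon>(3,4) by linarith+
    then show "a \<in> S"
      unfolding S_def mem_Times_iff mem_cball by simp
  qed
  obtain u where u: "u 0 = (y, \<epsilon> *\<^sub>R k)" "\<And>t. t \<in> {0..1} \<Longrightarrow> u t \<in> cball (y, \<epsilon> *\<^sub>R k) (3 * K * \<epsilon>)"
    "\<And>t. t \<in> {0..1} \<Longrightarrow> (u has_vector_derivative F (u t)) (at t within {0..1})"
  proof (rule picard[of S F "3 * K * \<epsilon>" "(y, \<epsilon> *\<^sub>R k)"])
    show "closed S" "convex S"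
      unfolding S_def by (intro closed_Times convex_Times closed_cball convex_cball)+
  qed (use lip bnd ball K \<epsilon>(1) in auto)
  have "u t \<in> S" if "t \<in> {0..1}" for t
    using u(2)[OF that] ball by blast
  then have "fst (u t) \<in> cball \<theta>0 (R / 2)" "norm (snd (u t)) \<le> 1" if "t \<in> {0..1}" for t
    using that by (force simp: S_def mem_Times_iff)+
  moreover have "((\<lambda>t. fst (u t)) has_vector_derivative fst (F (u t))) (at t within {0..1})"
      "((\<lambda>t. snd (u t)) has_vector_derivative snd (F (u t))) (at t within {0..1})" if "t \<in> {0..1}" for t
    using bounded_linear.has_vector_derivative[OF bounded_linear_fst u(3)[OF that]]
      bounded_linear.has_vector_derivative[OF bounded_linear_snd u(3)[OF that]] by auto
  ultimately have "flow y (\<lambda>t. fst (u t))" "variation y k (\<lambda>t. fst (u t)) (\<lambda>t. snd (u t))"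
    unfolding flow_def variation_def F_def by (auto simp: u(1) case_prod_beta)
  then show ?thesis by blast
qed

section \<open>Differentiability of the end point in the initial point\<close>

definition orbit :: "real^'n \<Rightarrow> real \<Rightarrow> real^'n" where
  "orbit y = (SOME \<gamma>. flow y \<gamma>)"

definition jacobi :: "real^'n \<Rightarrow> 'n \<Rightarrow> real \<Rightarrow> real^'n" where
  "jacobi y j = (SOME z. variation y (axis j 1) (orbit y) z)"

text \<open>The solution at time \<open>t\<close> of the variational equation with initial value
  \<open>k\<close>. Assembling it from basis solutions makes it linear in \<open>k\<close> by
  construction; the division undoes the scaling by \<open>\<epsilon>\<close>.\<close>

definition variation_map :: "real^'n \<Rightarrow> real \<Rightarrow> real^'n \<Rightarrow> real^'n" where
  "variation_map y t k = (\<Sum>j\<in>UNIV. (k $ j / \<epsilon>) *\<^sub>R jacobi y j t)"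

definition endpoint :: "real^'n \<Rightarrow> real^'n" where
  "endpoint y = orbit y 1"

lemma flow_orbit:
  assumes "y \<in> cball \<theta>0 \<epsilon>"
  shows "flow y (orbit y)"
  unfolding orbit_def using flow_variation_exists[OF assms, of 0] by (auto intro: someI[of "flow y"])

lemma orbit:
  assumes "y \<in> cball \<theta>0 \<epsilon>"
  shows "orbit y 0 = y" "t \<in> {0..1} \<Longrightarrow> orbit y t \<in> cball \<theta>0 (R / 2)" "t \<in> {0..1} \<Longrightarrow> orbit y t \<in> cball \<theta>0 R"
    "t \<in> {0..1} \<Longrightarrow> (orbit y has_vector_derivative - B (orbit y t) (y - \<theta>0)) (at t within {0..1})"
  using flow_orbit[OF assms] radius(2) by (auto simp: flow_def simp del: mem_cball)

text \<open>The existence lemma may return a different curve for each direction; uniqueness of the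
  flow lets one \<open>orbit y\<close> serve for all of them.\<close>

lemma variation_jacobi:
  assumes y: "y \<in> cball \<theta>0 \<epsilon>"
  shows "variation y (axis j 1) (orbit y) (jacobi y j)"
proof -
  obtain \<gamma> z where "flow y \<gamma>" "variation y (axis j 1) \<gamma> z"
    using flow_variation_exists[OF y, of "axis j 1"] by auto
  then have "variation y (axis j 1) (orbit y) z"
    using flow_unique[OF y flow_orbit[OF y]] by (simp add: variation_def)
  then show ?thesis
    unfolding jacobi_def by (rule someI[of "variation y (axis j 1) (orbit y)"])
qed

lemma jacobi:
  assumes "y \<in> cball \<theta>0 \<epsilon>"
  shows "jacobi y j 0 = \<epsilon> *\<^sub>R axis j 1" "t \<in> {0..1} \<Longrightarrow> norm (jacobi y j t) \<le> 1"
    "t \<in> {0..1} \<Longrightarrow> (jacobi y j has_vector_derivative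
      - B' (orbit y t) (jacobi y j t) (y - \<theta>0) - \<epsilon> *\<^sub>R B (orbit y t) (axis j 1)) (at t within {0..1})"
  using variation_jacobi[OF assms, of j] by (auto simp: variation_def)

lemma linear_variation_map: "linear (variation_map y t)"
  by (rule linearI) (simp_all add: variation_map_def add_divide_distrib scaleR_add_left sum.distrib
      scaleR_sum_right)

lemma variation_map_0:
  assumes "y \<in> cball \<theta>0 \<epsilon>"
  shows "variation_map y 0 k = k"
  using \<epsilon>(1) by (simp add: variation_map_def jacobi(1)[OF assms] vec_expansion)

lemma variation_map_derivative:
  assumes y: "y \<in> cball \<theta>0 \<epsilon>" and t: "t \<in> {0..1}"
  shows "((\<lambda>t. variation_map y t k) has_vector_derivative
    - B' (orbit y t) (variation_map y t k) (y - \<theta>0) - B (orbit y t) k) (at t within {0..1})"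
proof -
  interpret L: linear "\<lambda>w. B' (orbit y t) w (y - \<theta>0)"
    by (rule B'_linear[OF orbit(3)[OF y t]])
  interpret B: linear "B (orbit y t)"
    by (rule lin[OF orbit(3)[OF y t]])
  have "((\<lambda>t. variation_map y t k) has_vector_derivative
      (\<Sum>j\<in>UNIV. (k $ j / \<epsilon>) *\<^sub>R (- B' (orbit y t) (jacobi y j t) (y - \<theta>0) - \<epsilon> *\<^sub>R B (orbit y t) (axis j 1))))
      (at t within {0..1})"
    unfolding variation_map_def
    by (intro has_vector_derivative_sum bounded_linear.has_vector_derivative[OF bounded_linear_scaleR_right] jacobi y t)
  also have "(\<Sum>j\<in>UNIV. (k $ j / \<epsilon>) *\<^sub>R (- B' (orbit y t) (jacobi y j t) (y - \<theta>0) - \<epsilon> *\<^sub>R B (orbit y t) (axis j 1))) =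
      - (\<Sum>j\<in>UNIV. (k $ j / \<epsilon>) *\<^sub>R B' (orbit y t) (jacobi y j t) (y - \<theta>0))
      - (\<Sum>j\<in>UNIV. k $ j *\<^sub>R B (orbit y t) (axis j 1))"
    using \<epsilon>(1) by (simp add: scaleR_diff_right sum_subtractf sum_negf)
  also have "(\<Sum>j\<in>UNIV. (k $ j / \<epsilon>) *\<^sub>R B' (orbit y t) (jacobi y j t) (y - \<theta>0)) =
      B' (orbit y t) (variation_map y t k) (y - \<theta>0)"
    unfolding variation_map_def by (simp only: L.sum L.scale)
  also have "(\<Sum>j\<in>UNIV. k $ j *\<^sub>R B (orbit y t) (axis j 1)) = B (orbit y t) (\<Sum>j\<in>UNIV. k $ j *\<^sub>R axis j 1)"
    by (simp only: B.sum B.scale)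
  finally show ?thesis
    by (simp only: vec_expansion)
qed

definition M :: real where "M = real CARD('n) / \<epsilon>"

lemma M_pos: "M > 0"
  using \<epsilon>(1) by (simp add: M_def)

lemma norm_variation_map_le:
  assumes y: "y \<in> cball \<theta>0 \<epsilon>" and t: "t \<in> {0..1}"
  shows "norm (variation_map y t k) \<le> M * norm k"
proof -
  have "norm (variation_map y t k) \<le> (\<Sum>j\<in>(UNIV::'n set). norm k / \<epsilon>)"
    unfolding variation_map_def
  proof (rule sum_norm_le)
    fix j
    have "norm ((k $ j / \<epsilon>) *\<^sub>R jacobi y j t) = \<bar>k $ j\<bar> / \<epsilon> * norm (jacobi y j t)"
      using \<epsilon>(1) by simp
    also have "\<dots> \<le> norm k / \<epsilon> * 1"
      using \<epsilon>(1) component_le_norm_cart[of k j] jacobi(2)[OF y t, of j]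
      by (intro mult_mono divide_right_mono) auto
    finally show "norm ((k $ j / \<epsilon>) *\<^sub>R jacobi y j t) \<le> norm k / \<epsilon>" by simp
  qed
  then show ?thesis
    by (simp add: M_def)
qed

lemma norm_diff_base:
  assumes "y \<in> cball \<theta>0 \<epsilon>"
  shows "norm (y - \<theta>0) \<le> \<epsilon>"
  using assms by (simp add: dist_norm norm_minus_commute)

text \<open>The orbit of \<open>y\<close> plus its variation starts at \<open>y + k\<close> and
  solves the equation for \<open>y + k\<close> up to a defect quadratic in \<open>k\<close>. In the
  constant, \<open>K * M\<^sup>2 * \<epsilon>\<close> is the Taylor remainder of
  \<open>B(\<cdot>) (y - \<theta>0)\<close>, and \<open>K * M\<close> accounts for evaluating
  \<open>B(\<cdot>) k\<close> at a shifted point.\<close>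

lemma endpoint_quadratic:
  assumes y: "y \<in> cball \<theta>0 \<epsilon>" and yk: "y + k \<in> cball \<theta>0 \<epsilon>" and k: "M * norm k \<le> R / 2"
  shows "norm (endpoint (y + k) - endpoint y - variation_map y 1 k) \<le> 2 * (K * M\<^sup>2 * \<epsilon> + K * M) * (norm k)\<^sup>2"
proof -
  define v where "v t = orbit y t + variation_map y t k" for t
  have v: "v t \<in> cball \<theta>0 R" if t: "t \<in> {0..1}" for t
  proof -
    have "dist \<theta>0 (v t) \<le> dist \<theta>0 (orbit y t) + norm (variation_map y t k)"
      unfolding v_def using dist_triangle[of \<theta>0 _ "orbit y t"] by (metis dist_add_cancel dist_0_norm add.right_neutral)
    then show ?thesis
      using norm_variation_map_le[OF y t, of k] orbit(2)[OF y t] k by simp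
  qed
  have "norm (v 1 - orbit (y + k) 1) \<le> 2 * (norm (v 0 - (y + k)) + (K * M\<^sup>2 * \<epsilon> + K * M) * (norm k)\<^sup>2)"
  proof (rule flow_stability[OF yk flow_orbit[OF yk] v])
    fix t :: real assume t: "t \<in> {0..1}"
    let ?g = "orbit y t" and ?N = "variation_map y t k"
    show "(v has_vector_derivative - B ?g (y - \<theta>0) + (- B' ?g ?N (y - \<theta>0) - B ?g k)) (at t within {0..1})"
      unfolding v_def by (intro has_vector_derivative_add orbit variation_map_derivative y t)
    have N: "norm ?N \<le> M * norm k"
      by (rule norm_variation_map_le[OF y t])
    have "norm (B (v t) (y - \<theta>0) - B ?g (y - \<theta>0) - B' ?g (v t - ?g) (y - \<theta>0)) \<le> K * (norm (v t - ?g))\<^sup>2 * norm (y - \<theta>0)"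
      by (rule taylor[OF orbit(3)[OF y t] v[OF t]])
    also have "\<dots> \<le> K * (M * norm k)\<^sup>2 * \<epsilon>"
      using N norm_diff_base[OF y] K \<epsilon>(1) by (intro mult_mono power_mono) (auto simp: v_def)
    finally have 1: "norm (B (v t) (y - \<theta>0) - B ?g (y - \<theta>0) - B' ?g ?N (y - \<theta>0)) \<le> K * M\<^sup>2 * \<epsilon> * (norm k)\<^sup>2"
      by (simp add: v_def algebra_simps)
    have "norm (B (v t) k - B ?g k) \<le> K * norm (v t - ?g) * norm k"
      by (rule lipschitz[OF v[OF t] orbit(3)[OF y t]])
    also have "\<dots> \<le> K * (M * norm k) * norm k"
      using N K M_pos by (intro mult_mono) (auto simp: v_def)
    finally have 2: "norm (B (v t) k - B ?g k) \<le> K * M * (norm k)\<^sup>2"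
      by (simp add: power2_eq_square mult.assoc)
    have "- B ?g (y - \<theta>0) + (- B' ?g ?N (y - \<theta>0) - B ?g k) + B (v t) (y + k - \<theta>0) =
        (B (v t) (y - \<theta>0) - B ?g (y - \<theta>0) - B' ?g ?N (y - \<theta>0)) + (B (v t) k - B ?g k)"
      using linear_add[OF lin[OF v[OF t]], of "y - \<theta>0" k] by (simp add: algebra_simps)
    also have "norm \<dots> \<le> K * M\<^sup>2 * \<epsilon> * (norm k)\<^sup>2 + K * M * (norm k)\<^sup>2"
      by (intro norm_triangle_le add_mono 1 2)
    finally show "norm (- B ?g (y - \<theta>0) + (- B' ?g ?N (y - \<theta>0) - B ?g k) + B (v t) (y + k - \<theta>0)) \<le>
        (K * M\<^sup>2 * \<epsilon> + K * M) * (norm k)\<^sup>2"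
      by (simp add: algebra_simps)
  qed (simp_all add: atLeastAtMost_iff)
  moreover have "v 0 = y + k"
    by (simp add: v_def orbit(1)[OF y] variation_map_0[OF y])
  ultimately show ?thesis
    by (simp add: v_def endpoint_def norm_minus_commute algebra_simps)
qed

lemma endpoint_has_derivative:
  assumes y: "y \<in> ball \<theta>0 \<epsilon>"
  shows "(endpoint has_derivative variation_map y 1) (at y)"
  unfolding has_derivative_at_alt
proof (intro conjI allI impI)
  show "bounded_linear (variation_map y 1)"
    using linear_variation_map by (simp add: linear_conv_bounded_linear)
  fix e :: real assume "e > 0"
  define C where "C = 2 * (K * M\<^sup>2 * \<epsilon> + K * M)"
  have "C > 0"
    using K M_pos \<epsilon>(1) by (simp add: C_def add_pos_pos)
  obtain d where d: "d > 0" "ball y d \<subseteq> ball \<theta>0 \<epsilon>"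
    using y openE open_ball by metis
  show "\<exists>d>0. \<forall>z. norm (z - y) < d \<longrightarrow>
      norm (endpoint z - endpoint y - variation_map y 1 (z - y)) \<le> e * norm (z - y)"
  proof (intro exI[of _ "min d (min (R / 2 / M) (e / C))"] conjI allI impI)
    show "0 < min d (min (R / 2 / M) (e / C))"
      using d(1) radius(1) M_pos \<open>e > 0\<close> \<open>C > 0\<close> by simp
    fix z assume "norm (z - y) < min d (min (R / 2 / M) (e / C))"
    then have z: "norm (z - y) < d" "M * norm (z - y) \<le> R / 2" "C * norm (z - y) \<le> e"
      using M_pos \<open>C > 0\<close> by (auto simp: field_simps)
    have "z \<in> ball \<theta>0 \<epsilon>"
      using z(1) d(2) by (auto simp: dist_norm norm_minus_commute)
    then have "y + (z - y) \<in> cball \<theta>0 \<epsilon>"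
      by simp
    then have "norm (endpoint (y + (z - y)) - endpoint y - variation_map y 1 (z - y)) \<le> C * (norm (z - y))\<^sup>2"
      unfolding C_def using y z(2) by (intro endpoint_quadratic) auto
    also have "\<dots> = (C * norm (z - y)) * norm (z - y)"
      by (simp add: power2_eq_square)
    also have "\<dots> \<le> e * norm (z - y)"
      using z(3) by (rule mult_right_mono) simp
    finally show "norm (endpoint z - endpoint y - variation_map y 1 (z - y)) \<le> e * norm (z - y)"
      by simp
  qed
qed

text \<open>The orbit of \<open>x\<close> solves the equation for \<open>y\<close> with defect
  \<open>B (orbit x t) (y - x)\<close>.\<close>

lemma orbit_lipschitz:
  assumes y: "y \<in> cball \<theta>0 \<epsilon>" and x: "x \<in> cball \<theta>0 \<epsilon>" and t: "t \<in> {0..1}"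
  shows "norm (orbit x t - orbit y t) \<le> 2 * (1 + K) * norm (x - y)"
proof -
  have "norm (orbit x t - orbit y t) \<le> 2 * (norm (orbit x 0 - y) + K * norm (x - y))"
  proof (rule flow_stability[OF y flow_orbit[OF y] orbit(3,4)[OF x] _ t])
    fix t :: real assume t: "t \<in> {0..1}"
    have "norm (- B (orbit x t) (x - \<theta>0) + B (orbit x t) (y - \<theta>0)) = norm (B (orbit x t) (y - x))"
      using linear_diff[OF lin[OF orbit(3)[OF x t]], of "y - \<theta>0" "x - \<theta>0"] by simp
    then show "norm (- B (orbit x t) (x - \<theta>0) + B (orbit x t) (y - \<theta>0)) \<le> K * norm (x - y)"
      using bound[OF orbit(3)[OF x t], of "y - x"] by (simp add: norm_minus_commute)
  qed
  then show ?thesis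
    by (simp add: orbit(1)[OF x] algebra_simps)
qed

text \<open>This supplies continuity of the derivative of \<open>endpoint\<close>. The two equations
  differ in four ways: the orbit inside \<open>B'\<close>, the Jacobi field, the base vector
  \<open>y - \<theta>0\<close>, and the orbit inside the forcing term. The second is absorbed by the
  Gronwall estimate; the others are of order \<open>norm (x - y)\<close>.\<close>

lemma jacobi_lipschitz:
  assumes y: "y \<in> cball \<theta>0 \<epsilon>" and x: "x \<in> cball \<theta>0 \<epsilon>" and t: "t \<in> {0..1}"
  shows "norm (jacobi x j t - jacobi y j t) \<le> 2 * (4 * K * (1 + K) * \<epsilon> + K) * norm (x - y)"
proof -
  let ?d = "\<lambda>t. jacobi x j t - jacobi y j t"
  let ?C = "(4 * K * (1 + K) * \<epsilon> + K) * norm (x - y)"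
  have "norm (?d t) \<le> 2 * (norm (?d 0) + ?C)"
  proof (rule short_time_gronwall[OF has_vector_derivative_diff[OF jacobi(3)[OF x] jacobi(3)[OF y]] _ t])
    fix t :: real assume t: "t \<in> {0..1}"
    let ?gx = "orbit x t" and ?gy = "orbit y t" and ?zx = "jacobi x j t" and ?zy = "jacobi y j t"
    note gx = orbit(3)[OF x t] and gy = orbit(3)[OF y t]
    have g: "norm (?gy - ?gx) \<le> 2 * (1 + K) * norm (x - y)"
      using orbit_lipschitz[OF y x t] by (simp add: norm_minus_commute)
    have "norm (B' ?gy ?zx (x - \<theta>0) - B' ?gx ?zx (x - \<theta>0)) \<le> K * norm (?gy - ?gx) * norm ?zx * norm (x - \<theta>0)"
      by (rule lipschitz'[OF gy gx])
    also have "\<dots> \<le> K * (2 * (1 + K) * norm (x - y)) * 1 * \<epsilon>"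
      using g jacobi(2)[OF x t, of j] norm_diff_base[OF x] K \<epsilon>(1) by (intro mult_mono) auto
    finally have 1: "norm (B' ?gy ?zx (x - \<theta>0) - B' ?gx ?zx (x - \<theta>0)) \<le> 2 * K * (1 + K) * \<epsilon> * norm (x - y)"
      by (simp add: algebra_simps)
    have "norm (B' ?gy (?zy - ?zx) (x - \<theta>0)) \<le> K * norm (?zy - ?zx) * norm (x - \<theta>0)"
      by (rule bound'[OF gy])
    also have "\<dots> \<le> K * norm (?zy - ?zx) * \<epsilon>"
      using norm_diff_base[OF x] K by (intro mult_left_mono) auto
    also have "\<dots> = K * \<epsilon> * norm (?d t)"
      by (simp add: norm_minus_commute)
    also have "\<dots> \<le> 1 / 2 * norm (?d t)"
      using \<epsilon>(2) by (intro mult_right_mono) auto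
    finally have 2: "norm (B' ?gy (?zy - ?zx) (x - \<theta>0)) \<le> norm (?d t) / 2"
      by simp
    have "norm (B' ?gy ?zy (y - x)) \<le> K * norm ?zy * norm (y - x)"
      by (rule bound'[OF gy])
    also have "\<dots> \<le> K * 1 * norm (y - x)"
      using jacobi(2)[OF y t, of j] K by (intro mult_mono) auto
    finally have 3: "norm (B' ?gy ?zy (y - x)) \<le> K * norm (x - y)"
      by (simp add: norm_minus_commute)
    have "norm (\<epsilon> *\<^sub>R (B ?gy (axis j 1) - B ?gx (axis j 1))) \<le> \<epsilon> * (K * norm (?gy - ?gx) * norm (axis j (1::real)))"
      using lipschitz[OF gy gx, of "axis j 1"] \<epsilon>(1) by simp
    also have "\<dots> \<le> \<epsilon> * (K * (2 * (1 + K) * norm (x - y)) * 1)"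
      using g K \<epsilon>(1) by (intro mult_left_mono mult_mono) auto
    finally have 4: "norm (\<epsilon> *\<^sub>R (B ?gy (axis j 1) - B ?gx (axis j 1))) \<le> 2 * K * (1 + K) * \<epsilon> * norm (x - y)"
      by (simp add: algebra_simps)
    have dec: "- B' ?gx ?zx (x - \<theta>0) - \<epsilon> *\<^sub>R B ?gx (axis j 1) - (- B' ?gy ?zy (y - \<theta>0) - \<epsilon> *\<^sub>R B ?gy (axis j 1)) =
        (B' ?gy ?zx (x - \<theta>0) - B' ?gx ?zx (x - \<theta>0)) + B' ?gy (?zy - ?zx) (x - \<theta>0) + B' ?gy ?zy (y - x)
        + \<epsilon> *\<^sub>R (B ?gy (axis j 1) - B ?gx (axis j 1))"
      using linear_diff[OF lin'[OF gy], of ?zy "y - \<theta>0" "x - \<theta>0"] linear_diff[OF B'_linear[OF gy, of "x - \<theta>0"], of ?zy ?zx]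
      by (simp add: scaleR_diff_right)
    have fin: "norm (- B' ?gx ?zx (x - \<theta>0) - \<epsilon> *\<^sub>R B ?gx (axis j 1) - (- B' ?gy ?zy (y - \<theta>0) - \<epsilon> *\<^sub>R B ?gy (axis j 1)))
        \<le> 2 * K * (1 + K) * \<epsilon> * norm (x - y) + norm (?d t) / 2 + K * norm (x - y)
        + 2 * K * (1 + K) * \<epsilon> * norm (x - y)"
      unfolding dec by (intro norm_triangle_le add_mono 1 2 3 4)
    have eq: "2 * K * (1 + K) * \<epsilon> * a + b / 2 + K * a + 2 * K * (1 + K) * \<epsilon> * a =
        b / 2 + (4 * K * (1 + K) * \<epsilon> + K) * a" for a b
      by (simp add: algebra_simps)
    show "norm (- B' ?gx ?zx (x - \<theta>0) - \<epsilon> *\<^sub>R B ?gx (axis j 1) - (- B' ?gy ?zy (y - \<theta>0) - \<epsilon> *\<^sub>R B ?gy (axis j 1)))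
        \<le> norm (?d t) / 2 + ?C"
      using fin unfolding eq .
  qed
  then show ?thesis
    by (simp only: jacobi(1)[OF x] jacobi(1)[OF y] diff_self norm_zero add_0 mult.assoc)
qed

lemma Ck_on_endpoint: "Ck_on (Suc 0) (ball \<theta>0 \<epsilon>) endpoint"
proof (rule Ck_on_SucI[OF open_ball endpoint_has_derivative])
  have "continuous_on (ball \<theta>0 \<epsilon>) (\<lambda>y. jacobi y j 1)" for j
  proof (rule lipschitz_on_continuous_on)
    show "(2 * (4 * K * (1 + K) * \<epsilon> + K))-lipschitz_on (ball \<theta>0 \<epsilon>) (\<lambda>y. jacobi y j 1)"
      using K \<epsilon>(1) jacobi_lipschitz by (intro lipschitz_onI) (auto simp: dist_norm)
  qed
  then show "Ck_on 0 (ball \<theta>0 \<epsilon>) (\<lambda>y. variation_map y 1 v)" for v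
    unfolding variation_map_def Ck_on.simps by (intro continuous_intros)
qed

text \<open>
  By the commutation relation, \<open>(1 - t) B(\<gamma>(t)) k\<close> solves the variational equation along
  the orbit \<open>\<gamma>\<close> of \<open>y\<close>; it vanishes at time \<open>1\<close>.
\<close>

lemma endpoint_annihilates:
  assumes y: "y \<in> cball \<theta>0 \<epsilon>" and k: "B y k = k"
  shows "variation_map y 1 k = 0"
proof -
  define d where "d t = variation_map y t k - (1 - t) *\<^sub>R B (orbit y t) k" for t
  have "norm (d 1) \<le> 2 * (norm (d 0) + 0)"
  proof (rule short_time_gronwall)
    fix t :: real assume t: "t \<in> {0..1}"
    let ?g = "orbit y t"
    note g = orbit(3)[OF y t]
    have "((\<lambda>t. B (orbit y t) k) has_vector_derivative B' ?g (- B ?g (y - \<theta>0)) k) (at t within {0..1})"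
      using vector_derivative_diff_chain_within[OF orbit(4)[OF y t] has_derivative_at_withinI[OF deriv[OF g]]]
      by (simp add: o_def)
    then have *: "((\<lambda>t. (1 - t) *\<^sub>R B (orbit y t) k) has_vector_derivative
        (1 - t) *\<^sub>R B' ?g (- B ?g (y - \<theta>0)) k + (- 1) *\<^sub>R B ?g k) (at t within {0..1})"
      by (intro has_vector_derivative_scaleR) (auto intro!: derivative_eq_intros)
    have "(d has_vector_derivative - B' ?g (variation_map y t k) (y - \<theta>0) - B ?g k
        - ((1 - t) *\<^sub>R B' ?g (- B ?g (y - \<theta>0)) k + (- 1) *\<^sub>R B ?g k)) (at t within {0..1})"
      unfolding d_def by (intro has_vector_derivative_diff variation_map_derivative[OF y t] *)
    \<comment> \<open>The two terms \<open>B ?g k\<close> cancel, and \<open>commute\<close> moves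
      \<open>k\<close> into the direction argument of \<open>B'\<close>. What remains is linear and
      homogeneous in \<open>d\<close>.\<close>
    also have "- B' ?g (variation_map y t k) (y - \<theta>0) - B ?g k
        - ((1 - t) *\<^sub>R B' ?g (- B ?g (y - \<theta>0)) k + (- 1) *\<^sub>R B ?g k) = - B' ?g (d t) (y - \<theta>0)"
    proof -
      interpret L: linear "\<lambda>w. B' ?g w a" for a
        by (rule B'_linear[OF g])
      show ?thesis
        unfolding d_def by (simp add: L.diff L.scale L.neg commute[OF g, of "y - \<theta>0" k])
    qed
    finally show "(d has_vector_derivative - B' ?g (d t) (y - \<theta>0)) (at t within {0..1})" .
    have "norm (B' ?g (d t) (y - \<theta>0)) \<le> K * norm (d t) * norm (y - \<theta>0)"
      by (rule bound'[OF g])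
    also have "\<dots> \<le> K * norm (d t) * \<epsilon>"
      using norm_diff_base[OF y] K by (intro mult_left_mono) auto
    also have "\<dots> = (K * \<epsilon>) * norm (d t)"
      by simp
    also have "\<dots> \<le> 1 / 2 * norm (d t)"
      using \<epsilon>(2) by (intro mult_right_mono) auto
    finally show "norm (- B' ?g (d t) (y - \<theta>0)) \<le> norm (d t) / 2 + 0"
      by simp
  qed (simp_all add: atLeastAtMost_iff)
  moreover have "d 0 = 0"
    by (simp add: d_def orbit(1)[OF y] variation_map_0[OF y] k)
  ultimately show ?thesis
    by (simp add: d_def)
qed

text \<open>At \<open>\<theta>0\<close> the speed vanishes, so the orbit is constant and the
  variational equation reduces to a constant velocity \<open>- B \<theta>0 k\<close>.\<close>

lemma variation_map_base: "variation_map \<theta>0 1 k = k - B \<theta>0 k"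
proof -
  have \<theta>0: "\<theta>0 \<in> cball \<theta>0 \<epsilon>" "\<theta>0 \<in> cball \<theta>0 R"
    using \<epsilon>(1) radius(1) by auto
  have 0: "B g 0 = 0" "B' g w 0 = 0" if "g \<in> cball \<theta>0 R" for g w
    using linear_0[OF lin[OF that]] linear_0[OF lin'[OF that]] by auto
  have orbit_const: "orbit \<theta>0 t = \<theta>0" if "t \<in> {0..1}" for t
  proof (rule flow_unique[OF \<theta>0(1) flow_orbit[OF \<theta>0(1)] _ that])
    show "flow \<theta>0 (\<lambda>t. \<theta>0)"
      using radius(1) 0[OF \<theta>0(2)] by (auto simp: flow_def)
  qed
  define d where "d t = variation_map \<theta>0 t k - (k - t *\<^sub>R B \<theta>0 k)" for t
  have "norm (d 1) \<le> 2 * (norm (d 0) + 0)"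
  proof (rule short_time_gronwall[where d'="\<lambda>t. 0"])
    fix t :: real assume t: "t \<in> {0..1}"
    have "(d has_vector_derivative - B' (orbit \<theta>0 t) (variation_map \<theta>0 t k) (\<theta>0 - \<theta>0) - B (orbit \<theta>0 t) k
        - (0 - B \<theta>0 k)) (at t within {0..1})"
      unfolding d_def
      by (intro has_vector_derivative_diff variation_map_derivative[OF \<theta>0(1) t])
        (auto intro!: derivative_eq_intros simp: has_vector_derivative_def)
    then show "(d has_vector_derivative 0) (at t within {0..1})"
      using 0[OF \<theta>0(2)] by (simp add: orbit_const[OF t])
  qed simp_all
  moreover have "d 0 = 0"
    by (simp add: d_def variation_map_0[OF \<theta>0(1)])
  ultimately show ?thesis
    by (simp add: d_def)
qed

end

section \<open>Uniform constants for a smooth commuting frame\<close>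

lemma linear_norm_le_sum:
  fixes F :: "real^'n \<Rightarrow> 'b::real_normed_vector"
  assumes "linear F" "\<And>j. norm (F (axis j 1)) \<le> C j"
  shows "norm (F a) \<le> (\<Sum>j\<in>UNIV. C j) * norm a"
proof -
  have "F a = (\<Sum>j\<in>UNIV. a $ j *\<^sub>R F (axis j 1))"
    using linear_sum[OF assms(1), of "\<lambda>j. a $ j *\<^sub>R axis j 1" UNIV]
    by (simp only: vec_expansion linear_scale[OF assms(1)])
  also have "norm \<dots> \<le> (\<Sum>j\<in>UNIV. C j * norm a)"
  proof (rule sum_norm_le)
    fix j
    show "norm (a $ j *\<^sub>R F (axis j 1)) \<le> C j * norm a"
      using mult_mono[OF component_le_norm_cart[of a j] assms(2)[of j]] by (simp add: mult.commute)
  qed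
  finally show ?thesis
    by (simp add: sum_distrib_right)
qed

text \<open>Compactness gives a bound for each fixed argument only; linearity in \<open>a\<close>
  and \<open>w\<close> reduces these to basis vectors, and \<open>K\<close> adds up the finitely
  many constants. Second-order regularity makes \<open>B'\<close> Lipschitz, which in turn yields
  the quadratic Taylor remainder.\<close>

lemma commuting_frame_exists:
  fixes B :: "real^'n \<Rightarrow> real^'n \<Rightarrow> real^'n"
  assumes U: "open U" "\<theta>0 \<in> U"
    and lin: "\<And>y. y \<in> U \<Longrightarrow> linear (B y)"
    and C2: "\<And>a. Ck_on (Suc (Suc 0)) U (\<lambda>y. B y a)"
    and comm: "\<And>y a b. y \<in> U \<Longrightarrow>
      frechet_derivative (\<lambda>y. B y a) (at y) (B y b) = frechet_derivative (\<lambda>y. B y b) (at y) (B y a)"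
  obtains R K \<epsilon> where "ball \<theta>0 \<epsilon> \<subseteq> U"
    "commuting_frame B (\<lambda>y w a. frechet_derivative (\<lambda>y. B y a) (at y) w) \<theta>0 R K \<epsilon>"
proof -
  obtain R where R: "R > 0" "cball \<theta>0 R \<subseteq> U"
    using U open_contains_cball by blast
  define B' where "B' y w a = frechet_derivative (\<lambda>y. B y a) (at y) w" for y w a
  have der: "((\<lambda>y. B y a) has_derivative (\<lambda>w. B' y w a)) (at y)" if "y \<in> U" for y a
    unfolding B'_def using Ck_on_has_derivative[OF C2 that] .
  have lin': "linear (B' y w)" if "y \<in> U" for y w
  proof (rule linearI)
    fix a b c
    have "((\<lambda>y. B y (a + b)) has_derivative (\<lambda>w. B' y w a + B' y w b)) (at y)"
      by (rule has_derivative_transform_within_open[OF has_derivative_add[OF der[OF that, of a] der[OF that, of b]] U(1) that])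
        (simp add: linear_add[OF lin])
    then show "B' y w (a + b) = B' y w a + B' y w b"
      using has_derivative_unique[OF der[OF that, of "a + b"]] by metis
    have "((\<lambda>y. B y (c *\<^sub>R a)) has_derivative (\<lambda>w. c *\<^sub>R B' y w a)) (at y)"
      by (rule has_derivative_transform_within_open[OF has_derivative_scaleR_right[OF der[OF that, of a]] U(1) that])
        (simp add: linear_scale[OF lin])
    then show "B' y w (c *\<^sub>R a) = c *\<^sub>R B' y w a"
      using has_derivative_unique[OF der[OF that, of "c *\<^sub>R a"]] by metis
  qed
  have "\<exists>L>0. (\<forall>y\<in>cball \<theta>0 R. norm (B y a) \<le> L) \<and> (\<forall>y\<in>cball \<theta>0 R. \<forall>w. norm (B' y w a) \<le> L * norm w) \<and>
      (\<forall>y\<in>cball \<theta>0 R. \<forall>z\<in>cball \<theta>0 R. norm (B y a - B z a) \<le> L * norm (y - z))" for a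
    unfolding B'_def
    by (rule Ck_on_1_bounds[OF Ck_on_Suc_imp[OF C2[of a]] compact_cball convex_cball R(2)]) blast
  then obtain L where L: "\<And>a. L a > 0"
      "\<And>a y. y \<in> cball \<theta>0 R \<Longrightarrow> norm (B y a) \<le> L a"
      "\<And>a y w. y \<in> cball \<theta>0 R \<Longrightarrow> norm (B' y w a) \<le> L a * norm w"
      "\<And>a y z. y \<in> cball \<theta>0 R \<Longrightarrow> z \<in> cball \<theta>0 R \<Longrightarrow> norm (B y a - B z a) \<le> L a * norm (y - z)"
    by metis
  have "\<exists>L>0. \<forall>y\<in>cball \<theta>0 R. \<forall>z\<in>cball \<theta>0 R. norm (B' y w a - B' z w a) \<le> L * norm (y - z)" for w a
    unfolding B'_def
    by (rule Ck_on_1_bounds[OF Ck_on_frechet_derivative[OF C2[of a]] compact_cball convex_cball R(2), of w]) blast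
  then obtain L' where L': "\<And>w a. L' w a > 0"
      "\<And>w a y z. y \<in> cball \<theta>0 R \<Longrightarrow> z \<in> cball \<theta>0 R \<Longrightarrow> norm (B' y w a - B' z w a) \<le> L' w a * norm (y - z)"
    by metis
  let ?e = "\<lambda>j. axis j 1 :: real^'n"
  define K1 where "K1 = (\<Sum>j\<in>UNIV. L (?e j))"
  define K2 where "K2 = (\<Sum>j\<in>UNIV. \<Sum>i\<in>UNIV. L' (?e i) (?e j))"
  define K where "K = K1 + K2"
  have "K1 > 0" "K2 > 0"
    unfolding K1_def K2_def by (intro sum_pos L(1) L'(1); simp)+
  then have K: "K > 0" "K1 \<le> K" "K2 \<le> K"
    by (auto simp: K_def)
  have bound: "norm (B y a) \<le> K * norm a" if "y \<in> cball \<theta>0 R" for y a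
  proof -
    have "norm (B y a) \<le> K1 * norm a"
      unfolding K1_def using that R(2) by (intro linear_norm_le_sum lin L(2)) auto
    then show ?thesis
      using mult_right_mono[OF K(2), of "norm a"] by simp
  qed
  have bound': "norm (B' y w a) \<le> K * norm w * norm a" if "y \<in> cball \<theta>0 R" for y w a
  proof -
    have "norm (B' y w a) \<le> (\<Sum>j\<in>UNIV. L (?e j) * norm w) * norm a"
      using that R(2) by (intro linear_norm_le_sum lin' L(3)) auto
    also have "\<dots> = K1 * (norm w * norm a)"
      by (simp add: K1_def sum_distrib_right mult.assoc)
    also have "\<dots> \<le> K * (norm w * norm a)"
      using K(2) by (rule mult_right_mono) simp
    finally show ?thesis by (simp add: mult.assoc)
  qed
  have lipschitz: "norm (B y a - B z a) \<le> K * norm (y - z) * norm a"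
    if "y \<in> cball \<theta>0 R" "z \<in> cball \<theta>0 R" for y z a
  proof -
    have "norm (B y a - B z a) \<le> (\<Sum>j\<in>UNIV. L (?e j) * norm (y - z)) * norm a"
      using that R(2) by (intro linear_norm_le_sum[of "\<lambda>a. B y a - B z a"] linear_compose_sub lin L(4)) auto
    also have "\<dots> = K1 * (norm (y - z) * norm a)"
      by (simp add: K1_def sum_distrib_right mult.assoc)
    also have "\<dots> \<le> K * (norm (y - z) * norm a)"
      using K(2) by (rule mult_right_mono) simp
    finally show ?thesis by (simp add: mult.assoc)
  qed
  have lipschitz': "norm (B' y w a - B' z w a) \<le> K * norm (y - z) * norm w * norm a"
    if "y \<in> cball \<theta>0 R" "z \<in> cball \<theta>0 R" for y z w a
  proof -
    have yz: "y \<in> U" "z \<in> U"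
      using that R(2) by auto
    have "norm (B' y w (?e j) - B' z w (?e j)) \<le> (\<Sum>i\<in>UNIV. L' (?e i) (?e j) * norm (y - z)) * norm w" for j
      by (rule linear_norm_le_sum[of "\<lambda>w. B' y w (?e j) - B' z w (?e j)"])
        (intro linear_compose_sub has_derivative_linear[OF der] yz L'(2)[OF that])+
    then have "norm (B' y w a - B' z w a) \<le>
        (\<Sum>j\<in>UNIV. (\<Sum>i\<in>UNIV. L' (?e i) (?e j) * norm (y - z)) * norm w) * norm a"
      by (intro linear_norm_le_sum[of "\<lambda>a. B' y w a - B' z w a"] linear_compose_sub lin' yz)
    also have "\<dots> = K2 * (norm (y - z) * norm w * norm a)"
      by (simp add: K2_def sum_distrib_right mult.assoc)
    also have "\<dots> \<le> K * (norm (y - z) * norm w * norm a)"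
      using K(3) by (rule mult_right_mono) simp
    finally show ?thesis by (simp add: mult.assoc)
  qed
  have taylor: "norm (B z a - B y a - B' y (z - y) a) \<le> K * (norm (z - y))\<^sup>2 * norm a"
    if yz: "y \<in> cball \<theta>0 R" "z \<in> cball \<theta>0 R" for y z a
  proof -
    have seg: "closed_segment y z \<subseteq> cball \<theta>0 R"
      by (rule closed_segment_subset[OF yz convex_cball])
    have "norm (B z a - B y a - B' y (z - y) a) \<le> norm (z - y) * (K * norm (z - y) * norm a)"
    proof (rule differentiable_bound_linearization[where f'="\<lambda>x w. B' x w a" and S="closed_segment y z"])
      show "y + t *\<^sub>R (z - y) \<in> closed_segment y z" if "t \<in> {0..1}" for t
        using that by (auto simp: closed_segment_def algebra_simps intro!: exI[of _ t])
      fix x assume x: "x \<in> closed_segment y z"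
      then have xR: "x \<in> cball \<theta>0 R"
        using seg by blast
      then show "((\<lambda>x. B x a) has_derivative (\<lambda>w. B' x w a)) (at x within closed_segment y z)"
        using R(2) by (intro has_derivative_at_withinI[OF der]) auto
      have "norm (x - y) \<le> norm (z - y)"
        using segment_bound(1)[OF x] .
      have "norm (B' x w a - B' y w a) \<le> K * norm (z - y) * norm a * norm w" for w
      proof -
        have "norm (B' x w a - B' y w a) \<le> K * norm (x - y) * norm w * norm a"
          by (rule lipschitz'[OF xR yz(1)])
        also have "\<dots> \<le> K * norm (z - y) * norm w * norm a"
          using \<open>norm (x - y) \<le> norm (z - y)\<close> K(1) by (intro mult_right_mono mult_left_mono) auto
        finally show ?thesis by (simp only: mult.assoc mult.commute[of "norm w"])
      qed
      then show "onorm ((\<lambda>w. B' x w a) - (\<lambda>w. B' y w a)) \<le> K * norm (z - y) * norm a"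
        using K(1) by (intro onorm_bound) auto
    qed simp
    then show ?thesis
      by (simp add: power2_eq_square mult.assoc mult.left_commute)
  qed
  \<comment> \<open>With \<open>m\<close> the numerator,
    \<open>\<epsilon> + 8 * (K * \<epsilon>) = m\<close>; every smallness condition of the locale,
    and \<open>\<epsilon> \<le> R\<close>, follows linearly from this one equation.\<close>
  define \<epsilon> where "\<epsilon> = min 1 (min (R / 2) (1 / 2)) / (1 + 8 * K)"
  define m where "m = min 1 (min (R / 2) (1 / 2))"
  have m: "m > 0" "m \<le> 1" "m \<le> R / 2"
    using R(1) by (auto simp: m_def)
  have e1: "\<epsilon> > 0" "\<epsilon> * (1 + 8 * K) = m"
    using m(1) K(1) by (auto simp: \<epsilon>_def m_def[symmetric])
  have "K * \<epsilon> > 0"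
    using K(1) e1(1) by simp
  moreover have "\<epsilon> + 8 * (K * \<epsilon>) = m"
    using e1(2) by (simp add: algebra_simps)
  ultimately have \<epsilon>: "\<epsilon> > 0" "8 * K * \<epsilon> \<le> 1" "\<epsilon> + 3 * K * \<epsilon> \<le> R / 2" "\<epsilon> + 3 * K * \<epsilon> \<le> 1" "\<epsilon> \<le> R"
    using m e1(1) R(1) unfolding mult.assoc by linarith+
  have "commuting_frame B B' \<theta>0 R K \<epsilon>"
    by (rule commuting_frame.intro) (fact der[OF subsetD[OF R(2)]] lin[OF subsetD[OF R(2)]]
        lin'[OF subsetD[OF R(2)]] comm[OF subsetD[OF R(2)], folded B'_def]
        bound bound' lipschitz lipschitz' taylor K(1) \<epsilon>)+
  moreover have "B' = (\<lambda>y w a. frechet_derivative (\<lambda>y. B y a) (at y) w)"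
    by (intro ext) (simp add: B'_def)
  moreover have "ball \<theta>0 \<epsilon> \<subseteq> U"
    using \<epsilon>(5) R(2) by (auto simp: subset_iff)
  ultimately show ?thesis
    using that by blast
qed

text \<open>The final clause provides nondegeneracy: modulo the range of \<open>B \<theta>0\<close>,
  the derivative of \<open>H\<close> at \<open>\<theta>0\<close> is the identity.\<close>

lemma commuting_frame_first_integrals:
  fixes B :: "real^'n \<Rightarrow> real^'n \<Rightarrow> real^'n"
  assumes "open U" "\<theta>0 \<in> U"
    and "\<And>y. y \<in> U \<Longrightarrow> linear (B y)"
    and "\<And>a. Ck_on (Suc (Suc 0)) U (\<lambda>y. B y a)"
    and "\<And>y a b. y \<in> U \<Longrightarrow>
      frechet_derivative (\<lambda>y. B y a) (at y) (B y b) = frechet_derivative (\<lambda>y. B y b) (at y) (B y a)"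
  obtains V H where "open V" "\<theta>0 \<in> V" "V \<subseteq> U" "Ck_on (Suc 0) V H"
    "\<And>y k. y \<in> V \<Longrightarrow> B y k = k \<Longrightarrow> frechet_derivative H (at y) k = 0"
    "\<And>k. frechet_derivative H (at \<theta>0) k = k - B \<theta>0 k"
proof -
  obtain R K \<epsilon> where ball: "ball \<theta>0 \<epsilon> \<subseteq> U"
    and frame: "commuting_frame B (\<lambda>y w a. frechet_derivative (\<lambda>y. B y a) (at y) w) \<theta>0 R K \<epsilon>"
    using commuting_frame_exists[OF assms] by metis
  interpret commuting_frame B "\<lambda>y w a. frechet_derivative (\<lambda>y. B y a) (at y) w" \<theta>0 R K \<epsilon>
    by (rule frame)
  have D: "frechet_derivative endpoint (at y) = variation_map y 1" if "y \<in> ball \<theta>0 \<epsilon>" for y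
    using frechet_derivative_at[OF endpoint_has_derivative[OF that]] by simp
  have "\<theta>0 \<in> ball \<theta>0 \<epsilon>"
    using \<epsilon>(1) by simp
  then show ?thesis
    using ball Ck_on_endpoint endpoint_annihilates variation_map_base
    by (intro that[of "ball \<theta>0 \<epsilon>" endpoint]) (simp_all del: Ck_on.simps add: D)
qed

section \<open>Commuting frames from Lie algebras of constant rank\<close>

text \<open>By the Leibniz rule the bracket is a combination of the brackets of the
  \<open>X i\<close> plus a combination of the \<open>X i\<close> themselves. This is needed because
  \<open>B(\<cdot>) a\<close> has function coefficients over fields of the Lie algebra and need not
  belong to it.\<close>

lemma bracket_of_combinations:
  fixes X :: "'i \<Rightarrow> real^'n \<Rightarrow> real^'n"
  assumes X: "\<And>i. i \<in> I \<Longrightarrow> (X i has_derivative X' i) (at y)"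
    and f: "\<And>i. i \<in> I \<Longrightarrow> (f i has_derivative f' i) (at y)"
    and g: "\<And>i. i \<in> I \<Longrightarrow> (g i has_derivative g' i) (at y)"
    and V: "subspace V" "\<And>i. i \<in> I \<Longrightarrow> X i y \<in> V"
      "\<And>i j. i \<in> I \<Longrightarrow> j \<in> I \<Longrightarrow> X' i (X j y) - X' j (X i y) \<in> V"
    and F: "((\<lambda>z. \<Sum>i\<in>I. f i z *\<^sub>R X i z) has_derivative F) (at y)"
    and G: "((\<lambda>z. \<Sum>i\<in>I. g i z *\<^sub>R X i z) has_derivative G) (at y)"
  shows "F (\<Sum>i\<in>I. g i y *\<^sub>R X i y) - G (\<Sum>i\<in>I. f i y *\<^sub>R X i y) \<in> V"
proof -
  have *: "H v = (\<Sum>i\<in>I. h i y *\<^sub>R X' i v) + (\<Sum>i\<in>I. h' i v *\<^sub>R X i y)"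
    if h: "\<And>i. i \<in> I \<Longrightarrow> (h i has_derivative h' i) (at y)"
      and H: "((\<lambda>z. \<Sum>i\<in>I. h i z *\<^sub>R X i z) has_derivative H) (at y)" for h h' H v
  proof -
    have "((\<lambda>z. \<Sum>i\<in>I. h i z *\<^sub>R X i z) has_derivative
        (\<lambda>v. \<Sum>i\<in>I. h i y *\<^sub>R X' i v + h' i v *\<^sub>R X i y)) (at y)"
      by (intro has_derivative_sum has_derivative_scaleR h X)
    then have "H = (\<lambda>v. \<Sum>i\<in>I. h i y *\<^sub>R X' i v + h' i v *\<^sub>R X i y)"
      by (rule has_derivative_unique[OF H])
    then show ?thesis
      by (simp add: sum.distrib)
  qed
  have lin: "X' i (\<Sum>j\<in>I. h j *\<^sub>R X j y) = (\<Sum>j\<in>I. h j *\<^sub>R X' i (X j y))" if "i \<in> I" for i h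
  proof -
    interpret linear "X' i"
      by (rule has_derivative_linear[OF X[OF that]])
    show ?thesis
      by (simp only: sum scale)
  qed
  have expand: "(\<Sum>i\<in>I. p i *\<^sub>R X' i (\<Sum>j\<in>I. q j *\<^sub>R X j y)) = (\<Sum>i\<in>I. \<Sum>j\<in>I. (p i * q j) *\<^sub>R X' i (X j y))" for p q
    by (rule sum.cong[OF refl]) (simp add: lin scaleR_sum_right)
  have "(\<Sum>i\<in>I. f i y *\<^sub>R X' i (\<Sum>j\<in>I. g j y *\<^sub>R X j y)) - (\<Sum>i\<in>I. g i y *\<^sub>R X' i (\<Sum>j\<in>I. f j y *\<^sub>R X j y)) =
      (\<Sum>i\<in>I. \<Sum>j\<in>I. (f i y * g j y) *\<^sub>R X' i (X j y)) - (\<Sum>i\<in>I. \<Sum>j\<in>I. (f i y * g j y) *\<^sub>R X' j (X i y))"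
    unfolding expand by (subst sum.swap[of _ I I, where g="\<lambda>i j. (g i y * f j y) *\<^sub>R X' i (X j y)"]) (simp add: mult.commute)
  also have "\<dots> = (\<Sum>i\<in>I. \<Sum>j\<in>I. (f i y * g j y) *\<^sub>R (X' i (X j y) - X' j (X i y)))"
    by (simp add: sum_subtractf scaleR_diff_right)
  also have "\<dots> \<in> V"
    by (intro subspace_sum subspace_scale V)
  finally have 1: "(\<Sum>i\<in>I. f i y *\<^sub>R X' i (\<Sum>j\<in>I. g j y *\<^sub>R X j y)) -
      (\<Sum>i\<in>I. g i y *\<^sub>R X' i (\<Sum>j\<in>I. f j y *\<^sub>R X j y)) \<in> V" .
  have 2: "(\<Sum>i\<in>I. h i *\<^sub>R X i y) \<in> V" for h
    by (intro subspace_sum subspace_scale V)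
  have "F v = (\<Sum>i\<in>I. f i y *\<^sub>R X' i v) + (\<Sum>i\<in>I. f' i v *\<^sub>R X i y)" for v
    by (rule *[OF f F])
  moreover have "G v = (\<Sum>i\<in>I. g i y *\<^sub>R X' i v) + (\<Sum>i\<in>I. g' i v *\<^sub>R X i y)" for v
    by (rule *[OF g G])
  ultimately show ?thesis
    using subspace_add[OF V(1) 1 subspace_diff[OF V(1) 2[of "\<lambda>i. f' i (\<Sum>i\<in>I. g i y *\<^sub>R X i y)"]
          2[of "\<lambda>i. g' i (\<Sum>i\<in>I. f i y *\<^sub>R X i y)"]]]
    by (simp add: algebra_simps)
qed

section \<open>Smooth dependence of inverse matrices\<close>

lemma Ck_on_det:
  fixes A :: "'a::real_normed_vector \<Rightarrow> real^'n^'n"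
  assumes "open S" "\<And>i j. Ck_on k S (\<lambda>x. A x $ i $ j)"
  shows "Ck_on k S (\<lambda>x. det (A x))"
  unfolding det_def by (intro Ck_on_sum Ck_on_mult Ck_on_prod Ck_on_const assms)

lemma matrix_inv_right:
  assumes "invertible A"
  shows "A ** matrix_inv A = mat 1"
  using someI_ex[OF assms[unfolded invertible_def]] by (simp add: matrix_inv_def)

text \<open>Cramer's rule expresses each component as a polynomial in the entries of
  \<open>A x\<close> and \<open>v\<close>, divided by \<open>det (A x)\<close>.\<close>

lemma Ck_on_matrix_inv_mult:
  fixes A :: "'a::real_normed_vector \<Rightarrow> real^'n^'n"
  assumes "open S" "\<And>i j. Ck_on k S (\<lambda>x. A x $ i $ j)" "\<And>x. x \<in> S \<Longrightarrow> det (A x) \<noteq> 0"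
  shows "Ck_on k S (\<lambda>x. matrix_inv (A x) *v v)"
proof (rule Ck_on_cong[OF assms(1)])
  show "Ck_on k S (\<lambda>x. \<chi> l. det (\<chi> i j. if j = l then v $ i else A x $ i $ j) * inverse (det (A x)))"
  proof (rule Ck_on_vec[OF assms(1)], unfold vec_lambda_beta)
    fix l
    have "Ck_on k S (\<lambda>x. (\<chi> i j. if j = l then v $ i else A x $ i $ j) $ i $ j)" for i j
      using assms(2) Ck_on_const[OF assms(1)] by (cases "j = l") auto
    then show "Ck_on k S (\<lambda>x. det (\<chi> i j. if j = l then v $ i else A x $ i $ j) * inverse (det (A x)))"
      by (intro Ck_on_mult Ck_on_inverse Ck_on_det assms)
  qed
  fix x assume "x \<in> S"
  then have "A x ** matrix_inv (A x) = mat 1"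
    using assms(3) by (simp add: invertible_det_nz matrix_inv_right)
  then have "A x *v (matrix_inv (A x) *v v) = v"
    by (simp add: matrix_vector_mul_assoc)
  then show "(\<chi> l. det (\<chi> i j. if j = l then v $ i else A x $ i $ j) * inverse (det (A x))) = matrix_inv (A x) *v v"
    using cramer[OF assms(3)[OF \<open>x \<in> S\<close>]] by (simp add: divide_inverse)
qed

text \<open>The values at \<open>y\<close> of a linear space of fields already form a subspace.
  Hence each vector of the trace, not merely a spanning set, is the value of one field in
  \<open>L\<close>.\<close>

lemma trace_at_lie_subalgebra:
  assumes "lie_subalgebra \<Omega> L" "y \<in> \<Omega>"
  shows "trace_at L y = (\<lambda>\<xi>. \<xi> y) ` L"
proof -
  have "subspace ((\<lambda>\<xi>. \<xi> y) ` L)"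
  proof (rule subspaceI)
    show "0 \<in> (\<lambda>\<xi>. \<xi> y) ` L"
      using assms by (intro image_eqI[of _ _ "\<lambda>\<theta>\<in>\<Omega>. 0"]) (auto simp: lie_subalgebra_def)
    fix v w c assume "v \<in> (\<lambda>\<xi>. \<xi> y) ` L"
    then obtain \<xi> where \<xi>: "\<xi> \<in> L" "v = \<xi> y" by auto
    show "c *\<^sub>R v \<in> (\<lambda>\<xi>. \<xi> y) ` L"
      using assms \<xi> by (intro image_eqI[of _ _ "\<lambda>\<theta>\<in>\<Omega>. c *\<^sub>R \<xi> \<theta>"]) (auto simp: lie_subalgebra_def)
    assume "w \<in> (\<lambda>\<xi>. \<xi> y) ` L"
    then obtain \<eta> where "\<eta> \<in> L" "w = \<eta> y" by auto
    then show "v + w \<in> (\<lambda>\<xi>. \<xi> y) ` L"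
      using assms \<xi> by (intro image_eqI[of _ _ "\<lambda>\<theta>\<in>\<Omega>. \<xi> \<theta> + \<eta> \<theta>"]) (auto simp: lie_subalgebra_def)
  qed
  then show ?thesis
    unfolding trace_at_def by (simp add: span_eq_iff)
qed

text \<open>
  Let \<open>P\<close> be the orthogonal projection onto the trace at \<open>\<theta>0\<close>. Near \<open>\<theta>0\<close> it maps the trace at \<open>y\<close>
  isomorphically onto the one at \<open>\<theta>0\<close>; \<open>B y\<close> is \<open>P\<close> followed by the inverse of this isomorphism.
  The bracket of \<open>B(\<cdot>) a\<close> and \<open>B(\<cdot>) b\<close> takes values in the trace, and \<open>P\<close> kills it because
  \<open>P (B(\<cdot>) a)\<close> is constant; so it is zero.
\<close>

lemma lie_subalgebra_commuting_frame:
  fixes L :: "(real^'n \<Rightarrow> real^'n) set"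
  assumes L: "open \<Omega>" "lie_subalgebra \<Omega> L"
    and U0: "open U0" "\<theta>0 \<in> U0" "U0 \<subseteq> \<Omega>"
    and rank: "\<And>y. y \<in> U0 \<Longrightarrow> dim (trace_at L y) = dim (trace_at L \<theta>0)"
  obtains U B where "open U" "\<theta>0 \<in> U" "U \<subseteq> U0"
    "\<And>y. y \<in> U \<Longrightarrow> linear (B y)"
    "\<And>k a. Ck_on k U (\<lambda>y. B y a)"
    "\<And>y a b. y \<in> U \<Longrightarrow>
      frechet_derivative (\<lambda>y. B y a) (at y) (B y b) = frechet_derivative (\<lambda>y. B y b) (at y) (B y a)"
    "\<And>y v. y \<in> U \<Longrightarrow> v \<in> trace_at L y \<Longrightarrow> B y v = v"
    "\<And>v. B \<theta>0 v \<in> trace_at L \<theta>0"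
proof -
  have \<theta>0: "\<theta>0 \<in> \<Omega>"
    using U0 by auto
  note tr = trace_at_lie_subalgebra[OF L(2)]
  have sub: "subspace (trace_at L y)" for y
    by (simp add: trace_at_def)
  have smooth: "\<xi> \<in> smooth_fields \<Omega>" if "\<xi> \<in> L" for \<xi>
    using L(2) that by (auto simp: lie_subalgebra_def)
  define T where "T = trace_at L \<theta>0"
  obtain bs where bs: "bs \<subseteq> T" "pairwise orthogonal bs" "\<And>b. b \<in> bs \<Longrightarrow> norm b = 1"
    "independent bs" "span bs = T"
    using orthonormal_basis_subspace[OF sub[of \<theta>0]] unfolding T_def by metis
  have fin: "finite bs"
    using bs(4) by (rule independent_imp_finite)
  have "\<forall>b\<in>bs. \<exists>\<xi>\<in>L. \<xi> \<theta>0 = b"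
    using bs(1) unfolding T_def tr[OF \<theta>0] by auto
  then obtain X where X: "\<And>b. b \<in> bs \<Longrightarrow> X b \<in> L" "\<And>b. b \<in> bs \<Longrightarrow> X b \<theta>0 = b"
    by metis
  have XC: "Ck_on k \<Omega> (X b)" if "b \<in> bs" for b k
    using smooth[OF X(1)[OF that]] by (simp add: smooth_fields_def smooth_on_Ck)
  have inner_bs: "b \<bullet> c = (if b = c then 1 else 0)" if "b \<in> bs" "c \<in> bs" for b c
    using bs(2,3) that by (auto simp: pairwise_def orthogonal_def norm_eq_1)
  define P where "P v = (\<Sum>b\<in>bs. (b \<bullet> v) *\<^sub>R b)" for v
  \<comment> \<open>\<open>\<Xi> y\<close> carries the basis vector \<open>b\<close> of the trace at
    \<open>\<theta>0\<close> to \<open>X b y\<close> in the trace at \<open>y\<close>; at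
    \<open>\<theta>0\<close> it is \<open>P\<close>.\<close>
  define \<Xi> where "\<Xi> y v = (\<Sum>b\<in>bs. (b \<bullet> v) *\<^sub>R X b y)" for y v
  \<comment> \<open>On \<open>T\<close> this is \<open>P \<circ> \<Xi> y\<close>, on the orthogonal
    complement the identity. Extending to the whole space turns invertibility on \<open>T\<close>
    into a determinant condition, which is open and holds at \<open>\<theta>0\<close>.\<close>
  define C where "C y v = v - P v + P (\<Xi> y v)" for y v
  interpret P: linear P
    by (rule linearI) (simp_all add: P_def inner_add_right scaleR_add_left sum.distrib scaleR_sum_right)
  have \<Xi>lin: "linear (\<Xi> y)" for y
    by (rule linearI) (simp_all add: \<Xi>_def inner_add_right scaleR_add_left sum.distrib scaleR_sum_right)
  have inner_P: "b \<bullet> P v = b \<bullet> v" if "b \<in> bs" for b v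
  proof -
    have "b \<bullet> P v = (\<Sum>c\<in>bs. if c = b then b \<bullet> v else 0)"
      unfolding P_def inner_sum_right by (rule sum.cong[OF refl]) (auto simp: inner_bs that)
    then show ?thesis
      using fin that by (simp add: sum.delta)
  qed
  have PP: "P (P v) = P v" for v
    unfolding P_def[of "P v"] by (simp add: inner_P flip: P_def[of v])
  have PT: "P v \<in> T" for v
    unfolding P_def bs(5)[symmetric] by (intro span_sum span_scale span_base)
  have P_id: "P v = v" if "v \<in> T" for v
  proof -
    have "v \<in> span bs" using that bs(5) by simp
    then show ?thesis
    proof (induction rule: span_induct_alt)
      case (step c b w)
      have "P b = b"
      proof -
        have "P b = (\<Sum>c\<in>bs. if c = b then b else 0)"
          unfolding P_def by (rule sum.cong[OF refl]) (auto simp: inner_bs step.hyps)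
        then show ?thesis
          using fin step.hyps by (simp add: sum.delta)
      qed
      then show ?case
        using step by (simp add: P.add P.scale)
    qed (rule P.zero)
  qed
  have Clin: "linear (C y)" for y
    unfolding C_def
    by (intro linear_compose_add linear_compose_sub linear_id[unfolded id_def] P.linear_axioms
        linear_compose[OF \<Xi>lin P.linear_axioms, unfolded o_def])
  have C\<theta>0: "C \<theta>0 v = v" for v
  proof -
    have "\<Xi> \<theta>0 v = P v"
      unfolding \<Xi>_def P_def by (rule sum.cong) (simp_all add: X(2))
    then show ?thesis
      by (simp add: C_def PP)
  qed
  have PC: "P (C y v) = P (\<Xi> y v)" for y v
    by (simp add: C_def P.add P.diff PP)
  define A where "A y = matrix (C y)" for y
  have A: "A y *v v = C y v" for y v
    unfolding A_def by (simp add: Clin)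
  have AC: "Ck_on k \<Omega> (\<lambda>y. A y $ i $ j)" for k i j
  proof -
    have "bounded_linear P"
      using P.linear_axioms by (simp add: linear_conv_bounded_linear)
    then have "Ck_on k \<Omega> (\<lambda>y. C y (axis j 1) $ i)"
      unfolding C_def \<Xi>_def
      by (intro Ck_on_vec_nth Ck_on_add Ck_on_const Ck_on_sum Ck_on_bounded_linear[of P]
          Ck_on_bounded_linear[OF bounded_linear_scaleR_right] L(1) XC)
    then show ?thesis
      by (simp add: A_def matrix_def)
  qed
  have "A \<theta>0 = mat 1"
    by (rule matrix_eq[THEN iffD2]) (simp add: A C\<theta>0)
  then have det\<theta>0: "det (A \<theta>0) \<noteq> 0"
    by simp
  define U where "U = U0 \<inter> {y \<in> \<Omega>. det (A y) \<noteq> 0}"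
  have "open {y \<in> \<Omega>. det (A y) \<noteq> 0}"
  proof -
    have "continuous_on \<Omega> (\<lambda>y. det (A y))"
      by (rule Ck_on_imp_continuous_on[OF Ck_on_det[OF L(1) AC]])
    then have "open (\<Omega> \<inter> (\<lambda>y. det (A y)) -` (- {0}))"
      using L(1) by (intro continuous_open_preimage) auto
    moreover have "\<Omega> \<inter> (\<lambda>y. det (A y)) -` (- {0}) = {y \<in> \<Omega>. det (A y) \<noteq> 0}"
      by auto
    ultimately show ?thesis by simp
  qed
  then have U: "open U" "\<theta>0 \<in> U" "U \<subseteq> U0" "U \<subseteq> \<Omega>"
    using U0 det\<theta>0 \<theta>0 by (auto simp: U_def)
  define S where "S y v = matrix_inv (A y) *v v" for y v
  have CS: "C y (S y v) = v" if "y \<in> U" for y v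
  proof -
    have "A y ** matrix_inv (A y) = mat 1"
      using that by (simp add: U_def invertible_det_nz matrix_inv_right)
    then show ?thesis
      by (simp add: S_def matrix_vector_mul_assoc flip: A)
  qed
  have SC: "Ck_on k U (\<lambda>y. S y v)" for k v
    unfolding S_def
    by (rule Ck_on_matrix_inv_mult[OF U(1) Ck_on_subset[OF AC U(4)]]) (simp add: U_def)
  define B where "B y v = \<Xi> y (S y (P v))" for y v
  have Blin: "linear (B y)" for y
    unfolding B_def S_def
    by (intro linear_compose[OF linear_compose[OF P.linear_axioms matrix_vector_mul_linear] \<Xi>lin, unfolded o_def])
  have BC: "Ck_on k U (\<lambda>y. B y v)" for k v
    unfolding B_def \<Xi>_def
    by (intro Ck_on_sum Ck_on_scaleR Ck_on_bounded_linear[OF bounded_linear_inner_right] U(1) SC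
        Ck_on_subset[OF XC U(4)])
  have PB: "P (B y v) = P v" if "y \<in> U" for y v
    using PC[of y "S y (P v)"] by (simp add: B_def CS[OF that] PP)
  have Xtr: "X b y \<in> trace_at L y" if "b \<in> bs" for b y
    unfolding trace_at_def using X(1)[OF that] by (intro span_base) auto
  have Btr: "B y v \<in> trace_at L y" for y v
    unfolding B_def \<Xi>_def using Xtr by (intro subspace_sum subspace_scale sub)
  \<comment> \<open>Constant rank enters here. \<open>P\<close> undoes \<open>B y\<close> on
    \<open>T\<close>, so \<open>B y\<close> embeds \<open>T\<close> into the trace at
    \<open>y\<close>, and equality of dimensions makes it onto; thus \<open>P\<close> is injective
    on that trace.\<close>
  have inj: "w = 0" if y: "y \<in> U" and w: "w \<in> trace_at L y" "P w = 0" for y w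
  proof -
    have "inj_on (B y) T"
    proof (rule inj_onI)
      fix m n assume "m \<in> T" "n \<in> T" "B y m = B y n"
      then show "m = n"
        using PB[OF y, of m] PB[OF y, of n] P_id by metis
    qed
    then have "dim (B y ` T) = dim T"
      using bs(5) by (intro dim_image_eq[OF Blin]) (metis span_span)
    then have "B y ` T = trace_at L y"
      using Btr rank y U(3) by (intro subspace_dim_equal linear_subspace_image[OF Blin] sub)
        (auto simp: T_def sub)
    then obtain m where m: "m \<in> T" "w = B y m"
      using w(1) by auto
    then have "m = 0"
      using PB[OF y, of m] w(2) P_id by simp
    then show ?thesis
      using m(2) linear_0[OF Blin] by simp
  qed
  have Bfix: "B y v = v" if "y \<in> U" "v \<in> trace_at L y" for y v
  proof -
    have "B y v - v = 0"
      by (rule inj[OF that(1) subspace_diff[OF sub Btr that(2)]]) (simp add: P.diff PB[OF that(1)])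
    then show ?thesis by simp
  qed
  have comm: "frechet_derivative (\<lambda>y. B y a) (at y) (B y b) = frechet_derivative (\<lambda>y. B y b) (at y) (B y a)"
    if y: "y \<in> U" for y a b
  proof -
    let ?D = "\<lambda>a. frechet_derivative (\<lambda>y. B y a) (at y)"
    have D: "((\<lambda>y. B y a) has_derivative ?D a) (at y)" for a
      by (rule Ck_on_has_derivative[OF BC y])
    define f where "f a c z = c \<bullet> S z (P a)" for a c z
    have f: "(f a c has_derivative frechet_derivative (f a c) (at y)) (at y)" for a c
      unfolding f_def
      by (intro Ck_on_has_derivative[OF _ y] Ck_on_bounded_linear[OF bounded_linear_inner_right] U(1) SC)
    have yO: "y \<in> \<Omega>"
      using y U(4) by auto
    have Beq: "(\<lambda>y. B y a) = (\<lambda>z. \<Sum>c\<in>bs. f a c z *\<^sub>R X c z)" for a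
      by (simp add: B_def \<Xi>_def f_def)
    have Beq': "B y a = (\<Sum>c\<in>bs. f a c y *\<^sub>R X c y)" for a
      by (simp add: B_def \<Xi>_def f_def)
    have mem: "?D a (B y b) - ?D b (B y a) \<in> trace_at L y"
      unfolding Beq'[of a] Beq'[of b]
    proof (rule bracket_of_combinations[OF _ f f sub Xtr _ D[of a, unfolded Beq] D[of b, unfolded Beq], folded Beq])
      show "(X c has_derivative frechet_derivative (X c) (at y)) (at y)" if "c \<in> bs" for c
        by (rule smooth_fields_has_derivative[OF smooth[OF X(1)[OF that]] yO])
      show "frechet_derivative (X c) (at y) (X d y) - frechet_derivative (X d) (at y) (X c y) \<in> trace_at L y"
        if "c \<in> bs" "d \<in> bs" for c d
      proof -
        have "lie_bracket \<Omega> (X c) (X d) \<in> L"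
          using L(2) X(1) that by (simp add: lie_subalgebra_def)
        then have "lie_bracket \<Omega> (X c) (X d) y \<in> trace_at L y"
          unfolding tr[OF yO] by auto
        then show ?thesis
          using lie_bracket_apply[OF smooth[OF X(1)] smooth[OF X(1)] yO] that by simp
      qed
    qed
    have PD: "P (?D a v) = 0" for a v
    proof -
      have "((\<lambda>y. P (B y a)) has_derivative (\<lambda>v. P (?D a v))) (at y)"
        by (rule bounded_linear.has_derivative[OF _ D])
          (use P.linear_axioms in \<open>simp add: linear_conv_bounded_linear\<close>)
      moreover have "((\<lambda>y. P (B y a)) has_derivative (\<lambda>v. 0)) (at y)"
        by (rule has_derivative_transform_within_open[OF has_derivative_const[of "P a"] U(1) y]) (simp add: PB)
      ultimately show ?thesis
        using has_derivative_unique by metis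
    qed
    have "?D a (B y b) - ?D b (B y a) = 0"
      by (rule inj[OF y mem]) (simp only: P.diff PD diff_self)
    then show ?thesis by simp
  qed
  show ?thesis
    using U Blin BC comm Bfix Btr by (intro that[of U B]) auto
qed

section \<open>Existence of independent conservation laws\<close>

text \<open>In a relation with coefficients \<open>c\<close>, let \<open>s\<close> be the sum of
  their absolute values. Pairing with \<open>e i\<close> gives
  \<open>\<bar>c i\<bar> \<le> s / (1 + real N)\<close>; summing over the \<open>N\<close> indices
  gives \<open>s \<le> s * N / (1 + N)\<close>, hence \<open>s = 0\<close>. The tolerance is chosen
  for this strict loss.\<close>

lemma near_orthonormal_independent:
  fixes e g :: "nat \<Rightarrow> 'a::real_inner"
  assumes e: "\<And>i j. i < N \<Longrightarrow> j < N \<Longrightarrow> e i \<bullet> e j = (if i = j then 1 else 0)"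
    and g: "\<And>i. i < N \<Longrightarrow> norm (g i - e i) \<le> 1 / (1 + real N)"
  shows "inj_on g {..<N}" "independent (g ` {..<N})"
proof -
  have zero: "c i = 0" if c: "(\<Sum>j<N. c j *\<^sub>R g j) = 0" and "i < N" for c i
  proof -
    define s where "s = (\<Sum>j<N. \<bar>c j\<bar>)"
    have le: "\<bar>c i\<bar> \<le> s / (1 + real N)" if i: "i < N" for i
    proof -
      have "c i = (\<Sum>j<N. if j = i then c j else 0)"
        using i by (simp add: sum.delta)
      also have "\<dots> = (\<Sum>j<N. c j * (e i \<bullet> e j))"
        by (rule sum.cong) (auto simp: e i)
      also have "\<dots> = e i \<bullet> (\<Sum>j<N. c j *\<^sub>R e j) - e i \<bullet> (\<Sum>j<N. c j *\<^sub>R g j)"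
        by (simp add: c inner_sum_right)
      also have "\<dots> = e i \<bullet> (\<Sum>j<N. c j *\<^sub>R (e j - g j))"
        by (simp add: scaleR_diff_right sum_subtractf inner_diff_right)
      finally have "\<bar>c i\<bar> \<le> norm (e i) * norm (\<Sum>j<N. c j *\<^sub>R (e j - g j))"
        using Cauchy_Schwarz_ineq2 by metis
      also have "norm (e i) = 1"
        using e[OF i i] by (simp add: norm_eq_1)
      also have "norm (\<Sum>j<N. c j *\<^sub>R (e j - g j)) \<le> (\<Sum>j<N. \<bar>c j\<bar> / (1 + real N))"
      proof (rule sum_norm_le)
        fix j assume "j \<in> {..<N}"
        then have "\<bar>c j\<bar> * norm (e j - g j) \<le> \<bar>c j\<bar> * (1 / (1 + real N))"
          using g[of j] by (intro mult_left_mono) (auto simp: norm_minus_commute)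
        then show "norm (c j *\<^sub>R (e j - g j)) \<le> \<bar>c j\<bar> / (1 + real N)" by simp
      qed
      finally show ?thesis
        by (simp add: s_def sum_divide_distrib)
    qed
    have "s \<le> (\<Sum>j<N. s / (1 + real N))"
      unfolding s_def by (rule sum_mono) (use le s_def in auto)
    then have "s * (1 + real N) \<le> s * real N"
      by (simp add: field_simps)
    then have "s \<le> 0"
      by (simp add: algebra_simps)
    then show ?thesis
      using le[OF \<open>i < N\<close>] divide_nonpos_nonneg[of s "1 + real N"] by simp
  qed
  show inj: "inj_on g {..<N}"
  proof (rule inj_onI, rule ccontr)
    fix i j assume ij: "i \<in> {..<N}" "j \<in> {..<N}" "g i = g j" "i \<noteq> j"
    \<comment> \<open>Two equal vectors at distinct indices would be a relation with coefficients 1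
      and -1.\<close>
    define c :: "nat \<Rightarrow> real" where "c l = (if l = i then 1 else 0) - (if l = j then 1 else 0)" for l
    have "(\<Sum>l<N. c l *\<^sub>R g l) = (\<Sum>l<N. (if l = i then g l else 0) - (if l = j then g l else 0))"
      by (rule sum.cong) (auto simp: c_def)
    also have "\<dots> = (\<Sum>l<N. if l = i then g l else 0) - (\<Sum>l<N. if l = j then g l else 0)"
      by (rule sum_subtractf)
    also have "\<dots> = 0"
      using ij by (simp add: sum.delta)
    finally have "c i = 0"
      using zero ij by auto
    then show False
      using ij by (simp add: c_def)
  qed
  show "independent (g ` {..<N})"
  proof (rule independent_if_scalars_zero)
    fix f x assume "(\<Sum>x\<in>g ` {..<N}. f x *\<^sub>R x) = 0" "x \<in> g ` {..<N}"
    then show "f x = 0"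
      using zero[of "\<lambda>j. f (g j)"] by (auto simp: sum.reindex[OF inj])
  qed simp
qed

theorem theorem3p3:
  fixes \<Omega> :: "(real^'n) set" and \<phi> :: "real^'n \<Rightarrow> real^'d"
  assumes "open \<Omega>"
    and "smooth_on \<Omega> \<phi>"
    and "\<forall>\<theta>\<in>\<Omega>. \<exists>U. open U \<and> \<theta> \<in> U \<and> U \<subseteq> \<Omega> \<and>
           (\<lambda>\<theta>'. dim (trace_at (Lie \<Omega> (W_space \<Omega> \<phi>)) \<theta>')) constant_on U"
  shows "\<forall>\<theta>\<in>\<Omega>. \<exists>\<Omega>'. open \<Omega>' \<and> \<theta> \<in> \<Omega>' \<and> \<Omega>' \<subseteq> \<Omega> \<and>
           (\<exists>h. independent_conservation_laws \<Omega> \<phi> \<Omega>'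
                  (CARD('n) - dim (trace_at (Lie \<Omega> (W_space \<Omega> \<phi>)) \<theta>)) h) \<and>
           (\<forall>N h. independent_conservation_laws \<Omega> \<phi> \<Omega>' N h \<longrightarrow>
                  N \<le> CARD('n) - dim (trace_at (Lie \<Omega> (W_space \<Omega> \<phi>)) \<theta>))"
proof
  fix \<theta> assume \<theta>: "\<theta> \<in> \<Omega>"
  define L where "L = Lie \<Omega> (W_space \<Omega> \<phi>)"
  define T where "T = trace_at L \<theta>"
  define N where "N = CARD('n) - dim T"
  obtain U0 where U0: "open U0" "\<theta> \<in> U0" "U0 \<subseteq> \<Omega>" "(\<lambda>\<theta>'. dim (trace_at L \<theta>')) constant_on U0"
    using assms(3) \<theta> unfolding L_def by blast
  have rank: "dim (trace_at L y) = dim (trace_at L \<theta>)" if "y \<in> U0" for y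
    using U0(2,4) that unfolding constant_on_def by metis
  have L: "lie_subalgebra \<Omega> L"
    unfolding L_def by (rule lie_subalgebra_Lie[OF assms(1) W_space_subset_smooth_fields[OF assms(1,2)]])
  obtain U B where U: "open U" "\<theta> \<in> U" "U \<subseteq> U0" and B: "\<And>y. y \<in> U \<Longrightarrow> linear (B y)"
    "\<And>k a. Ck_on k U (\<lambda>y. B y a)"
    "\<And>y a b. y \<in> U \<Longrightarrow>
      frechet_derivative (\<lambda>y. B y a) (at y) (B y b) = frechet_derivative (\<lambda>y. B y b) (at y) (B y a)"
    "\<And>y v. y \<in> U \<Longrightarrow> v \<in> trace_at L y \<Longrightarrow> B y v = v"
    "\<And>v. B \<theta> v \<in> trace_at L \<theta>"
    by (rule lie_subalgebra_commuting_frame[OF assms(1) L U0(1-3) rank]) (assumption, rule that)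
  obtain V H where V: "open V" "\<theta> \<in> V" "V \<subseteq> U" and H: "Ck_on (Suc 0) V H"
    "\<And>y k. y \<in> V \<Longrightarrow> B y k = k \<Longrightarrow> frechet_derivative H (at y) k = 0"
    "\<And>k. frechet_derivative H (at \<theta>) k = k - B \<theta> k"
    by (rule commuting_frame_first_integrals[OF U(1,2) B(1,2,3)]) (assumption | rule that)+
  have "V \<subseteq> \<Omega>"
    using V(3) U(3) U0(3) by blast
  define T' where "T' = {v \<in> UNIV. \<forall>x\<in>T. orthogonal x v}"
  have "dim T' + dim T = dim (UNIV :: (real^'n) set)"
    unfolding T'_def by (rule dim_subspace_orthogonal_to_vectors) (auto simp: T_def trace_at_def)
  then have dim: "dim T' = N"
    by (simp add: N_def)
  have "subspace T'"
    unfolding T'_def by (auto simp: subspace_def orthogonal_clauses)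
  then obtain es where es: "es \<subseteq> T'" "pairwise orthogonal es" "\<And>x. x \<in> es \<Longrightarrow> norm x = 1"
    "independent es" "card es = N"
    using orthonormal_basis_subspace dim by metis
  obtain e where e: "bij_betw e {..<N} es"
    using ex_bij_betw_nat_finite[OF independent_imp_finite[OF es(4)]] es(5) by (auto simp: atLeast0LessThan)
  have e_in: "e i \<in> es" if "i < N" for i
    using e that by (auto simp: bij_betw_def)
  have e_orth: "e i \<bullet> e j = (if i = j then 1 else 0)" if "i < N" "j < N" for i j
  proof (cases "i = j")
    case True
    then show ?thesis
      using es(3)[OF e_in[OF that(1)]] by (simp add: norm_eq_1)
  next
    case False
    then have "e i \<noteq> e j"
      using e that by (auto simp: bij_betw_def inj_on_def)
    then show ?thesis
      using es(2) e_in that False by (auto simp: pairwise_def orthogonal_def)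
  qed
  define h where "h i x = e i \<bullet> H x" for i x
  have hC: "Ck_on (Suc 0) V (h i)" for i
    unfolding h_def[abs_def] by (rule Ck_on_bounded_linear[OF bounded_linear_inner_right V(1) H(1)])
  have hD: "frechet_derivative (h i) (at y) v = e i \<bullet> frechet_derivative H (at y) v" if "y \<in> V" for i y v
  proof -
    have "(h i has_derivative (\<lambda>v. e i \<bullet> frechet_derivative H (at y) v)) (at y)"
      unfolding h_def[abs_def]
      by (rule bounded_linear.has_derivative[OF bounded_linear_inner_right Ck_on_has_derivative[OF H(1) that]])
    from frechet_derivative_at[OF this] show ?thesis by metis
  qed
  have grad_h: "grad (h i) y \<bullet> v = e i \<bullet> frechet_derivative H (at y) v" if "y \<in> V" for i y v
    using hC[of i] that by (subst grad_inner) (auto simp: hD)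
  \<comment> \<open>The correction \<open>B \<theta> v\<close> lies in the trace at \<theta>, to
    which \<open>e i\<close> is orthogonal, so the gradients at \<theta> are exactly the orthonormal
    vectors chosen.\<close>
  have grad_\<theta>: "grad (h i) \<theta> = e i" if "i < N" for i
  proof (rule vector_eq_rdot[THEN iffD1], rule allI)
    fix v
    have "e i \<bullet> B \<theta> v = 0"
      using es(1) e_in[OF that] B(5)[of v] by (auto simp: T'_def T_def orthogonal_def inner_commute)
    then show "grad (h i) \<theta> \<bullet> v = e i \<bullet> v"
      by (simp add: grad_h V(2) H(3) inner_diff_right)
  qed
  \<comment> \<open>The radius is the tolerance of \<open>near_orthonormal_independent\<close>. The
    extra intersection with \<open>V\<close> matters for \<open>N = 0\<close>, where the indexed
    intersection is the whole space.\<close>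
  define \<Omega>' where "\<Omega>' = (\<Inter>i<N. {y \<in> V. dist (grad (h i) y) (e i) < 1 / (1 + real N)}) \<inter> V"
  have "open {y \<in> V. dist (grad (h i) y) (e i) < 1 / (1 + real N)}" for i
  proof -
    have "continuous_on V (grad (h i))"
      unfolding grad_def[abs_def] using hC[of i] by (intro continuous_on_vec_lambda) simp
    then have "open (V \<inter> grad (h i) -` ball (e i) (1 / (1 + real N)))"
      using V(1) by (intro continuous_open_preimage) auto
    moreover have "V \<inter> grad (h i) -` ball (e i) (1 / (1 + real N)) = {y \<in> V. dist (grad (h i) y) (e i) < 1 / (1 + real N)}"
      by (auto simp: dist_commute)
    ultimately show ?thesis by simp
  qed
  then have "open \<Omega>'"
    unfolding \<Omega>'_def using V(1) by (intro open_Int open_INT) auto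
  have "\<Omega>' \<subseteq> V"
    by (auto simp: \<Omega>'_def)
  then have sub: "\<Omega>' \<subseteq> \<Omega>"
    using \<open>V \<subseteq> \<Omega>\<close> by blast
  have "\<theta> \<in> \<Omega>'"
    using V(2) grad_\<theta> by (auto simp: \<Omega>'_def)
  have "conservation_law \<Omega> \<phi> \<Omega>' (h i)" for i
    unfolding conservation_law_def conserved_through_def
  proof (intro ballI allI impI)
    fix \<eta> x0 J u
    assume "\<eta> \<in> (\<lambda>\<xi>. restrict \<xi> \<Omega>') ` W_space \<Omega> \<phi>" and max: "is_maximal_solution \<Omega>' \<eta> x0 J u"
    then obtain \<xi> where \<xi>: "\<xi> \<in> W_space \<Omega> \<phi>" "\<eta> = restrict \<xi> \<Omega>'" by auto
    show "(\<lambda>t. h i (u t)) constant_on J"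
    proof (rule constant_along_solution)
      show "is_solution \<Omega>' \<eta> x0 J u"
        using max by (simp add: is_maximal_solution_def)
      fix y assume y: "y \<in> \<Omega>'"
      then have "y \<in> V"
        using \<open>\<Omega>' \<subseteq> V\<close> by auto
      then show "h i differentiable (at y)"
        using hC[of i] by auto
      have "\<xi> \<in> L"
        using \<xi>(1) hull_subset[of "W_space \<Omega> \<phi>" "lie_subalgebra \<Omega>"] by (auto simp: L_def Lie_def)
      \<comment> \<open>So \<open>B y\<close> fixes \<open>\<xi> y\<close>, and the derivative of
        \<open>H\<close> at \<open>y\<close> kills it.\<close>
      then have "\<xi> y \<in> trace_at L y"
        unfolding trace_at_def by (intro span_base) auto
      then show "frechet_derivative (h i) (at y) (\<eta> y) = 0"
        using y \<open>y \<in> V\<close> V(3) B(4) H(2) by (simp add: hD \<xi>(2) subset_iff)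
    qed
  qed
  moreover have "Ck_on 1 \<Omega>' (h i)" for i
    using Ck_on_subset[OF hC \<open>\<Omega>' \<subseteq> V\<close>] by simp
  moreover have "inj_on (\<lambda>i. grad (h i) y) {..<N}" "independent ((\<lambda>i. grad (h i) y) ` {..<N})" if "y \<in> \<Omega>'" for y
    using near_orthonormal_independent[of N e "\<lambda>i. grad (h i) y"] e_orth that
    by (auto simp: \<Omega>'_def dist_norm less_imp_le)
  ultimately have "independent_conservation_laws \<Omega> \<phi> \<Omega>' N h"
    unfolding independent_conservation_laws_def by blast
  then show "\<exists>\<Omega>'. open \<Omega>' \<and> \<theta> \<in> \<Omega>' \<and> \<Omega>' \<subseteq> \<Omega> \<and>
      (\<exists>h. independent_conservation_laws \<Omega> \<phi> \<Omega>' (CARD('n) - dim (trace_at (Lie \<Omega> (W_space \<Omega> \<phi>)) \<theta>)) h) \<and>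
      (\<forall>N h. independent_conservation_laws \<Omega> \<phi> \<Omega>' N h \<longrightarrow>
        N \<le> CARD('n) - dim (trace_at (Lie \<Omega> (W_space \<Omega> \<phi>)) \<theta>))"
    using \<open>open \<Omega>'\<close> \<open>\<theta> \<in> \<Omega>'\<close> sub independent_conservation_laws_le[OF assms(1,2) \<open>open \<Omega>'\<close> sub \<open>\<theta> \<in> \<Omega>'\<close>]
    unfolding N_def T_def L_def by (intro exI[of _ \<Omega>'] conjI allI impI) auto
qed

end
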